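(* Let $d,r\in\mathbb{N}$ and $m\in\mathbb{N}_0$. Let $\Lambda=\{\nu_1,\ldots,\nu_r\}\subseteq\Lambda_m$ with $\nu_1=\mathbf{0}$ and $T=\{\tau_1,\ldots,\tau_r\}\subseteq\mathbb{R}^d$ be ordered multisets. Suppose that the generalized Hermite subdivision scheme of type $\Lambda$ with mask $a\in(l_0(\mathbb{Z}^d))^{r\times r}$ is convergent with limit functions in $\mathscr{C}^m(\mathbb{R}^d)$. Let $\phi$ be its basis vector function. For any integer $M\ge m$, the following are equivalent to each other: (1) The mask $a$ has order $M+1$ sum rules with a matching filter $\upsilon_a\in(l_0(\mathbb{Z}^d))^{1\times r}$ satisfying $$\widehat{\upsilon_a}(\xi)=\left[(i\xi)^{\nu_1}e^{i\tau_1\cdot\xi},\ldots,(i\xi)^{\nu_r}e^{i\tau_r\cdot\xi}\right]+\mathscr{O}(\|\xi\|^{M+1}),\quad\xi\to0.$$ (2) The polynomial-interpolation property of order $M+1$ holds: for all $\mathsf{p}\in\Pi_M$ and $n\in\mathbb{N}_0$, $$\mathcal{S}_a^n\left[\mathsf{p}^{(\nu_1)}(\cdot+\tau_1),\ldots,\mathsf{p}^{(\nu_r)}(\cdot+\tau_r)\right]=\left[[\mathsf{p}(2^{-n}\cdot)]^{(\nu_1)}(\cdot+\tau_1),\ldots,[\mathsf{p}(2^{-n}\cdot)]^{(\nu_r)}(\cdot+\tau_r)\right].$$ (3) For every $\mathsf{p}\in\Pi_M$, with the initial sequence $w_0:=[\mathsf{p}^{(\nu_1)}(\cdot+\tau_1),\ldots,\mathsf{p}^{(\nu_r)}(\cdot+\tau_r)]$,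 $$w_n:=(\mathcal{S}_a^nw_0)\mathsf{D}_\Lambda^{-n}=\left[\mathsf{p}^{(\nu_1)}(2^{-n}(\cdot+\tau_1)),\ldots,\mathsf{p}^{(\nu_r)}(2^{-n}(\cdot+\tau_r))\right],\qquad\forall\,n\in\mathbb{N}_0.$$ Moreover, any one of the three equivalent items (1)--(3) implies: (i) For every $\mathsf{p}\in\Pi_M$ and the initial sequence $w_0:=[\mathsf{p}^{(\nu_1)}(\cdot+\tau_1),\ldots,\mathsf{p}^{(\nu_r)}(\cdot+\tau_r)]$, the limit $$\lim_{n\to\infty}\max_{k\in\mathbb{Z}^d\cap[-2^nK,2^nK]^d}|w_n(k)e_\ell-\eta^{(\nu_\ell)}(2^{-n}(k+\tau_\ell))|=0,\qquad\forall\,\ell=1,\ldots,r,\ K>0,$$ trivially holds with $\eta:=w_0*\phi=\sum_{k\in\mathbb{Z}^d}w_0(k)\phi(\cdot-k)$; that is, $w_n(k)e_\ell=\eta^{(\nu_\ell)}(2^{-n}(k+\tau_\ell))$ for all $\ell=1,\ldots,r$, $k\in\mathbb{Z}^d$ and $n\in\mathbb{N}$. (ii) For any mapping $\theta:\{1,\ldots,r\}\to\{1,\ldots,r\}$ satisfying $\nu_{\theta(\ell)}=\nu_\ell$ for all $\ell=1,\ldots,r$, the identities $$w_n(2k+2\tau_\ell-\tau_{\theta(\ell)})e_{\theta(\ell)}=w_{n-1}(k)e_\ell,\qquad\forall\,k\in\mathbb{Z}^d,\ n\in\mathbb{N},\ \ell=1,\ldots,r,$$ hold with $w_0:=[\mathsf{p}^{(\nu_1)}(\cdot+\tau_1),\ldots,\mathsf{p}^{(\nu_r)}(\cdot+\tau_r)]$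 for all $\mathsf{p}\in\Pi_M$.
   Context: Notation. $\mathbb{N}_0=\mathbb{N}\cup\{0\}$. $(l(\mathbb{Z}^d))^{s\times r}$ is the space of all sequences $u:\mathbb{Z}^d\to\mathbb{C}^{s\times r}$; $(l_0(\mathbb{Z}^d))^{s\times r}$ the finitely supported ones, with $\widehat{u}(\xi):=\sum_{k}u(k)e^{-ik\cdot\xi}$. $\boldsymbol{\delta}(0)=1$, $\boldsymbol{\delta}(k)=0$ for $k\in\mathbb{Z}^d\setminus\{0\}$. $e_\ell$ is the $\ell$th unit coordinate column vector of $\mathbb{R}^r$. Usual multi-index notation; $f^{(\mu)}:=\partial^\mu f$; $(i\xi)^\mu=i^{|\mu|}\xi^\mu$. $\Lambda_m:=\{\mu\in\mathbb{N}_0^d:|\mu|\le m\}$. Ordered multisets may have repeated elements. $\mathscr{C}^m(\mathbb{R}^d)$: functions with continuous partial derivatives up to order $m$. $\Pi_M$: $d$-variate polynomials of total degree at most $M$; polynomials are identified with their restrictions to $\mathbb{Z}^d$. "$f(\xi)=g(\xi)+\mathscr{O}(\|\xi\|^{n+1})$, $\xi\to0$" means $f^{(\mu)}(0)=g^{(\mu)}(0)$ for all $|\mu|\le n$. Subdivision operator: $(\mathcal{S}_av)(j):=2^d\sum_{k\in\mathbb{Z}^d}v(k)a(j-2k)$, $j\in\mathbb{Z}^d$, for $v\in(l(\mathbb{Z}^d))^{s\times r}$. Generalized Hermite subdivision scheme of type $\Lambda$ with mask $a$: with $\mathsf{D}_\Lambda:=\mathrm{diag}(2^{-|\nu_1|},\ldots,2^{-|\nu_r|})$,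 from $w_0\in(l(\mathbb{Z}^d))^{1\times r}$ compute $w_n:=(\mathcal{S}_a^nw_0)\mathsf{D}_\Lambda^{-n}$, $n\in\mathbb{N}$. It is convergent with limit functions in $\mathscr{C}^m(\mathbb{R}^d)$ if for every $w_0\in(l(\mathbb{Z}^d))^{1\times r}$ there is $\eta\in\mathscr{C}^m(\mathbb{R}^d)$ such that for every $K>0$ and all $\ell=1,\ldots,r$, $\lim_{n\to\infty}\max_{k\in\mathbb{Z}^d\cap[-2^nK,2^nK]^d}|w_n(k)e_\ell-\eta^{(\nu_\ell)}(2^{-n}k)|=0$. Its basis vector function $\phi=[\phi_1,\ldots,\phi_r]^{\mathsf{T}}$ is defined by $\lim_{n\to\infty}\sup_{k\in\mathbb{Z}^d}\|(\mathcal{S}_a^n(\boldsymbol{\delta}I_r))(k)e_1-\phi(2^{-n}k)\|=0$; i.e. $\phi_j$ is the limit function for $w_0=\boldsymbol{\delta}e_j^{\mathsf{T}}$. Sum rules: $a$ has order $M+1$ sum rules with a matching filter $\upsilon_a\in(l_0(\mathbb{Z}^d))^{1\times r}$ if $\widehat{\upsilon_a}(0)\ne0$ and, as $\xi\to0$, $\widehat{\upsilon_a}(2\xi)\widehat{a}(\xi)=\widehat{\upsilon_a}(\xi)+\mathscr{O}(\|\xi\|^{M+1})$ and $\widehat{\upsilon_a}(2\xi)\widehat{a}(\xi+\pi\omega)=\mathscr{O}(\|\xi\|^{M+1})$ for all $\omega\in\Gamma\setminus\{0\}$, $\Gamma:=[0,1]^d\cap\mathbb{Z}^d$. In item (ii)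 the condition $2\tau_\ell-\tau_{\theta(\ell)}\in\mathbb{Z}^d$ is not required: there all $w_n$ are vector polynomials, hence are regarded as defined on $\mathbb{R}^d$ rather than only on $\mathbb{Z}^d$. *)

theory Defs
  imports "HOL-Analysis.Analysis"
begin

section \<open>Multi-indices, partial derivatives, polynomials\<close>

type_synonym 'd multiindex = "nat ^ 'd"
type_synonym 'd rvec = "real ^ 'd"
type_synonym 'd ivec = "int ^ 'd"

definition mabs :: "'d::finite multiindex \<Rightarrow> nat" where
  "mabs \<mu> = (\<Sum>i\<in>UNIV. \<mu> $ i)"

definition mpower :: "'d::finite rvec \<Rightarrow> 'd multiindex \<Rightarrow> real" where
  "mpower x \<mu> = (\<Prod>i\<in>UNIV. (x $ i) ^ (\<mu> $ i))"

definition along :: "('d::finite rvec \<Rightarrow> 'a) \<Rightarrow> 'd rvec \<Rightarrow> 'd \<Rightarrow> real \<Rightarrow> 'a" where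
  "along f x i = (\<lambda>t. f (x + t *\<^sub>R axis i 1))"

definition pdiff :: "'d::finite \<Rightarrow> ('d rvec \<Rightarrow> 'a::real_normed_vector) \<Rightarrow> 'd rvec \<Rightarrow> 'a" where
  "pdiff i f x = vector_derivative (along f x i) (at 0)"

text \<open>The linear order on the index type of the coordinates only serves to fix the order in which
  the partial derivatives are taken, which is immaterial for the functions considered here.\<close>

definition mdiff ::
    "'d::{finite,linorder} multiindex \<Rightarrow> ('d rvec \<Rightarrow> 'a::real_normed_vector) \<Rightarrow> 'd rvec \<Rightarrow> 'a"
  where "mdiff \<mu> f = foldr (\<lambda>i. pdiff i ^^ (\<mu> $ i)) (sorted_list_of_set UNIV) f"

primrec Cm :: "nat \<Rightarrow> ('d::finite rvec \<Rightarrow> 'a::real_normed_vector) \<Rightarrow> bool" where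
  "Cm 0 f \<longleftrightarrow> continuous_on UNIV f"
| "Cm (Suc m) f \<longleftrightarrow> continuous_on UNIV f \<and>
     (\<forall>i. (\<forall>x. along f x i differentiable at 0) \<and> Cm m (pdiff i f))"

text \<open>Polynomials of total degree at most \<open>M\<close>, with complex coefficients, as functions on
  \<open>\<real>\<^sup>d\<close>.\<close>

definition polys :: "nat \<Rightarrow> ('d::finite rvec \<Rightarrow> complex) set" where
  "polys M = {p. \<exists>c. p = (\<lambda>x. \<Sum>\<mu> | mabs \<mu> \<le> M. c \<mu> * complex_of_real (mpower x \<mu>))}"

text \<open>\<open>f(\<xi>) = g(\<xi>) + O(\<parallel>\<xi>\<parallel>\<^sup>N)\<close> as \<open>\<xi> \<rightarrow> 0\<close>, in the sense of agreement of all derivatives of order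
  less than \<open>N\<close> at the origin.\<close>

definition eq_upto_O ::
    "nat \<Rightarrow> ('d::{finite,linorder} rvec \<Rightarrow> 'a::real_normed_vector) \<Rightarrow> ('d rvec \<Rightarrow> 'a) \<Rightarrow> bool"
  where "eq_upto_O N f g \<longleftrightarrow> (\<forall>\<mu>. mabs \<mu> < N \<longrightarrow> mdiff \<mu> f 0 = mdiff \<mu> g 0)"


section \<open>Sequences on the integer lattice\<close>

text \<open>A sequence of \<open>s \<times> r\<close> matrices has type \<open>('d, 'r, 's) mseq\<close>; row vectors are the case where
  \<open>'s\<close> is the one-element type \<open>1\<close>, whose only index is also written \<open>1\<close>.\<close>

type_synonym ('d, 'r, 's) mseq = "'d ivec \<Rightarrow> complex ^ 'r ^ 's"

definition emb :: "'d::finite ivec \<Rightarrow> 'd rvec" where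
  "emb k = (\<chi> i. real_of_int (k $ i))"

definition lattice_box :: "real \<Rightarrow> 'd::finite ivec set" where
  "lattice_box R = {k. \<forall>i. \<bar>real_of_int (k $ i)\<bar> \<le> R}"

definition finitely_supported :: "('d::finite, 'r::finite, 's::finite) mseq \<Rightarrow> bool" where
  "finitely_supported u \<longleftrightarrow> finite {k. u k \<noteq> 0}"

definition delta_mat :: "('d::finite, 'r::finite, 'r) mseq" where
  "delta_mat = (\<lambda>k. if k = 0 then mat 1 else 0)"

definition fourier ::
    "('d::finite, 'r::finite, 's::finite) mseq \<Rightarrow> 'd rvec \<Rightarrow> complex ^ 'r ^ 's" where
  "fourier u \<xi> = (\<chi> i j. \<Sum>k | u k \<noteq> 0. u k $ i $ j * exp (- (\<i> * complex_of_real (emb k \<bullet> \<xi>))))"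


section \<open>Generalized Hermite subdivision schemes\<close>

definition subdiv ::
    "('d::finite, 'r::finite, 'r) mseq \<Rightarrow> ('d, 'r, 's::finite) mseq \<Rightarrow> ('d, 'r, 's) mseq" where
  "subdiv a v = (\<lambda>j. 2 ^ CARD('d) *\<^sub>R (\<Sum>k | a (j - 2 *s k) \<noteq> 0. v k ** a (j - 2 *s k)))"

text \<open>The integer power \<open>D\<^sub>\<Lambda>\<^sup>z\<close> of the diagonal matrix \<open>D\<^sub>\<Lambda>\<close> with diagonal entries \<open>2\<^sup>-\<^sup>|\<^sup>\<nu>\<^sup>|\<close>.\<close>

definition D_power :: "('r \<Rightarrow> 'd::finite multiindex) \<Rightarrow> int \<Rightarrow> complex ^ 'r::finite ^ 'r" where
  "D_power \<nu> z = (\<chi> i j. if i = j then ((1/2) ^ mabs (\<nu> i)) powi z else 0)"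

definition hermite_scheme ::
    "('r \<Rightarrow> 'd::finite multiindex) \<Rightarrow> ('d, 'r::finite, 'r) mseq \<Rightarrow> ('d, 'r, 1) mseq \<Rightarrow> nat
      \<Rightarrow> ('d, 'r, 1) mseq" where
  "hermite_scheme \<nu> a w0 n = (\<lambda>k. (subdiv a ^^ n) w0 k ** D_power \<nu> (- int n))"

definition hermite_convergent ::
    "nat \<Rightarrow> ('r \<Rightarrow> 'd::{finite,linorder} multiindex) \<Rightarrow> ('d, 'r::finite, 'r) mseq \<Rightarrow> bool" where
  "hermite_convergent m \<nu> a \<longleftrightarrow>
    (\<forall>w0. \<exists>\<eta>::'d rvec \<Rightarrow> complex. Cm m \<eta> \<and>
      (\<forall>K>0. \<forall>l.
        (\<lambda>n. Max ((\<lambda>k. cmod (hermite_scheme \<nu> a w0 n k $ 1 $ l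
                              - mdiff (\<nu> l) \<eta> ((1/2) ^ n *\<^sub>R emb k)))
                  ` lattice_box (2 ^ n * K)))
        \<longlonglongrightarrow> 0))"

text \<open>\<open>i1\<close> is the index of the component with \<open>\<nu> = 0\<close>. The regularity of \<open>\<phi>\<close> has to be stated: the
  limit only determines the values of \<open>\<phi>\<close> at dyadic points.\<close>

definition basis_vector_function ::
    "nat \<Rightarrow> 'r \<Rightarrow> ('d::finite, 'r::finite, 'r) mseq \<Rightarrow> ('d rvec \<Rightarrow> complex ^ 'r) \<Rightarrow> bool" where
  "basis_vector_function m i1 a \<phi> \<longleftrightarrow>
    (\<forall>j. Cm m (\<lambda>x. \<phi> x $ j)) \<and>
    (\<lambda>n. SUP k. ennreal (norm (column i1 ((subdiv a ^^ n) delta_mat k)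
                                - \<phi> ((1/2) ^ n *\<^sub>R emb k)))) \<longlonglongrightarrow> 0"

text \<open>The convolution \<open>w0 * \<phi>\<close>; for compactly supported \<open>\<phi>\<close> the sum is finite at each point.\<close>

definition conv_basis ::
    "('d::finite, 'r::finite, 1) mseq \<Rightarrow> ('d rvec \<Rightarrow> complex ^ 'r) \<Rightarrow> 'd rvec \<Rightarrow> complex" where
  "conv_basis w0 \<phi> x = (\<Sum>\<^sub>\<infinity>k\<in>UNIV. (w0 k *v \<phi> (x - emb k)) $ 1)"


section \<open>Sum rules and polynomial reproduction\<close>

definition sum_rules ::
    "nat \<Rightarrow> ('d::{finite,linorder}, 'r::finite, 'r) mseq \<Rightarrow> ('d, 'r, 1) mseq \<Rightarrow> bool" where
  "sum_rules N a \<upsilon> \<longleftrightarrow>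
    finitely_supported \<upsilon> \<and> fourier \<upsilon> 0 \<noteq> 0 \<and>
    eq_upto_O N (\<lambda>\<xi>. fourier \<upsilon> (2 *\<^sub>R \<xi>) ** fourier a \<xi>) (fourier \<upsilon>) \<and>
    (\<forall>\<omega>::'d ivec. (\<forall>i. 0 \<le> \<omega> $ i \<and> \<omega> $ i \<le> 1) \<and> \<omega> \<noteq> 0 \<longrightarrow>
      eq_upto_O N (\<lambda>\<xi>. fourier \<upsilon> (2 *\<^sub>R \<xi>) ** fourier a (\<xi> + pi *\<^sub>R emb \<omega>)) (\<lambda>_. 0))"

definition hermite_sum_rules ::
    "nat \<Rightarrow> ('r \<Rightarrow> 'd::{finite,linorder} multiindex) \<Rightarrow> ('r \<Rightarrow> 'd rvec)
      \<Rightarrow> ('d, 'r::finite, 'r) mseq \<Rightarrow> bool" where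
  "hermite_sum_rules N \<nu> \<tau> a \<longleftrightarrow>
    (\<exists>\<upsilon>. sum_rules N a \<upsilon> \<and>
      eq_upto_O N (fourier \<upsilon>)
        (\<lambda>\<xi>. \<chi> _ l. \<i> ^ mabs (\<nu> l) * complex_of_real (mpower \<xi> (\<nu> l))
                    * exp (\<i> * complex_of_real (\<tau> l \<bullet> \<xi>))))"

definition hermite_data ::
    "('r \<Rightarrow> 'd::{finite,linorder} multiindex) \<Rightarrow> ('r \<Rightarrow> 'd rvec) \<Rightarrow> ('d rvec \<Rightarrow> complex)
      \<Rightarrow> ('d, 'r::finite, 1) mseq" where
  "hermite_data \<nu> \<tau> p = (\<lambda>k. \<chi> _ l. mdiff (\<nu> l) p (emb k + \<tau> l))"

definition polynomial_interpolation ::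
    "nat \<Rightarrow> ('r \<Rightarrow> 'd::{finite,linorder} multiindex) \<Rightarrow> ('r \<Rightarrow> 'd rvec)
      \<Rightarrow> ('d, 'r::finite, 'r) mseq \<Rightarrow> bool" where
  "polynomial_interpolation M \<nu> \<tau> a \<longleftrightarrow>
    (\<forall>p\<in>polys M. \<forall>n.
      (subdiv a ^^ n) (hermite_data \<nu> \<tau> p) = hermite_data \<nu> \<tau> (\<lambda>x. p ((1/2) ^ n *\<^sub>R x)))"

definition scheme_reproduces_polynomials ::
    "nat \<Rightarrow> ('r \<Rightarrow> 'd::{finite,linorder} multiindex) \<Rightarrow> ('r \<Rightarrow> 'd rvec)
      \<Rightarrow> ('d, 'r::finite, 'r) mseq \<Rightarrow> bool" where
  "scheme_reproduces_polynomials M \<nu> \<tau> a \<longleftrightarrow>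
    (\<forall>p\<in>polys M. \<forall>n.
      hermite_scheme \<nu> a (hermite_data \<nu> \<tau> p) n
        = (\<lambda>k. \<chi> _ l. mdiff (\<nu> l) p ((1/2) ^ n *\<^sub>R (emb k + \<tau> l))))"

text \<open>\<open>W\<close> is a vector polynomial on \<open>\<real>\<^sup>d\<close> whose restriction to the lattice is \<open>w\<close>. Such a \<open>W\<close> is
  uniquely determined by \<open>w\<close>.\<close>

definition vector_polynomial_extension ::
    "('d::finite, 'r::finite, 1) mseq \<Rightarrow> ('d rvec \<Rightarrow> complex ^ 'r ^ 1) \<Rightarrow> bool" where
  "vector_polynomial_extension w W \<longleftrightarrow>
    (\<forall>l. \<exists>N. (\<lambda>x. W x $ 1 $ l) \<in> polys N) \<and> (\<forall>k. W (emb k) = w k)"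

end

theory Submission
  imports Defs
begin

text \<open>The derivative of order \<open>\<mu>\<close> at \<open>0\<close> of \<open>\<xi> \<mapsto> (i\<xi>)\<^sup>\<alpha> exp(i y\<cdot>\<xi>)\<close> is, up to the factor \<open>i\<^sup>|\<^sup>\<mu>\<^sup>|\<close>, the
  derivative of order \<open>\<alpha>\<close> of the monomial \<open>x\<^sup>\<mu>\<close> at \<open>y\<close>. Hence reproduction of Hermite data of
  polynomials of degree at most \<open>M\<close> by one subdivision step says that, on every coset of \<open>2\<int>\<^sup>d\<close>, the
  target \<open>((i\<xi>)\<^sup>\<nu> exp(i \<tau>\<cdot>\<xi>))\<close> taken at \<open>2\<xi>\<close> times the coset symbol of the mask agrees to order
  \<open>M + 1\<close> with \<open>2\<^sup>-\<^sup>d\<close> times the target at \<open>\<xi>\<close>. Fourier inversion on the group \<open>\<int>\<^sup>d / 2\<int>\<^sup>d\<close> turns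
  these relations into the sum rules for the target, and a finitely supported filter with the
  prescribed jet exists by polynomial interpolation on a lattice cube.

  For the limit function, \<open>S\<^sup>n w\<close> is a convolution of \<open>w\<close> with the \<open>n\<close>th iterated mask. At dyadic
  points its component with \<open>\<nu> = 0\<close> therefore tends to \<open>w * \<phi>\<close>, while by reproduction it tends to \<open>p\<close>;
  by continuity \<open>w * \<phi> = p\<close> everywhere.\<close>

text \<open>\<open>mdiff\<close> is an ordered iteration of \<open>pdiff\<close>, and
  \<open>pdiff\<close> carries information only where a derivative exists. All identities are
  therefore proved inside \<open>exppoly\<close>, where derivatives exist and mixed ones commute by
  structural induction. The class contains both the symbols and the targets, whose frequencies
  \<open>\<tau> l\<close> are arbitrary real vectors. For this reason the target is in general not
  the symbol of a finitely supported sequence, and only jets can be matched. Since jets multiply,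
  the sum rules depend on the filter only through its jet, and the intermediate relations are
  written with the target itself. The duality between monomials and jets has a generating function:
  \<open>hexp \<alpha> y \<xi>\<close> is the x-derivative of order \<alpha> of exp(i x.\<xi>) at x
  = y, while the \<xi>-derivative of order \<mu> of exp(i x.\<xi>) at 0 is
  \<open>\<i> ^ mabs \<mu>\<close> times the monomial in x. The factor 2^(-|\<mu>|) produced by
  p(x/2) becomes the dilation of \<xi> by 2. In the limit argument a fixed dyadic point is followed
  through ever finer levels, so that one finite set of indices serves all of them.\<close>

section \<open>Partial derivatives of exponential polynomials\<close>

text \<open>Otherwise the simplifier rewrites the unit multi-index \<open>axis i 1\<close> to \<open>axis i (Suc 0)\<close>.\<close>

declare One_nat_def [simp del]

text \<open>The set \<open>X\<close> collects the admissible frequencies: \<open>exppoly {}\<close> consists of the polynomials, and all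
  symbols of finitely supported sequences have components in \<open>exppoly UNIV\<close>.\<close>

inductive_set exppoly :: "'d::finite rvec set \<Rightarrow> ('d rvec \<Rightarrow> complex) set" for X where
  const: "(\<lambda>_. c) \<in> exppoly X"
| coord: "(\<lambda>x. complex_of_real (x $ i)) \<in> exppoly X"
| exp: "y \<in> X \<Longrightarrow> (\<lambda>x. exp (\<i> * complex_of_real (y \<bullet> x))) \<in> exppoly X"
| add: "f \<in> exppoly X \<Longrightarrow> g \<in> exppoly X \<Longrightarrow> (\<lambda>x. f x + g x) \<in> exppoly X"
| mult: "f \<in> exppoly X \<Longrightarrow> g \<in> exppoly X \<Longrightarrow> (\<lambda>x. f x * g x) \<in> exppoly X"

lemma has_pdiff_const: "(along (\<lambda>_. c) x i has_vector_derivative 0) (at 0)"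
  by (simp add: along_def)

lemma has_pdiff_coord:
  "(along (\<lambda>x. complex_of_real (x $ j)) x i has_vector_derivative (if i = j then 1 else 0)) (at 0)"
  unfolding along_def
  by (auto simp: axis_def intro!: derivative_eq_intros)

lemma has_pdiff_exp:
  "(along (\<lambda>x. exp (\<i> * complex_of_real (y \<bullet> x))) x i has_vector_derivative
     \<i> * complex_of_real (y $ i) * exp (\<i> * complex_of_real (y \<bullet> x))) (at 0)"
proof -
  have "((\<lambda>z. exp (\<i> * (complex_of_real (y \<bullet> x) + z * complex_of_real (y $ i))))
      has_field_derivative \<i> * complex_of_real (y $ i) * exp (\<i> * complex_of_real (y \<bullet> x)))
      (at (of_real 0))"
    by (auto intro!: derivative_eq_intros)
  from has_vector_derivative_real_field[OF this] show ?thesis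
    by (simp add: along_def inner_add_right inner_axis)
qed

text \<open>\<open>vector_derivative\<close> is a choice operator, so closure under differentiation
  is first proved as existence of a derivative inside the class. The calculus of
  \<open>pdiff\<close> then follows by uniqueness of derivatives.\<close>

lemma exppoly_has_pdiff:
  assumes "f \<in> exppoly X"
  shows "\<exists>g\<in>exppoly X. \<forall>x. (along f x i has_vector_derivative g x) (at 0)"
  using assms
proof induction
  case (const c)
  show ?case
    by (intro bexI[of _ "\<lambda>_. 0"] allI has_pdiff_const exppoly.const)
next
  case (coord j)
  show ?case
    using has_pdiff_coord by (intro bexI[of _ "\<lambda>_. if i = j then 1 else 0"]) (blast intro: exppoly.const)+
next
  case (exp y)
  then show ?case
    using has_pdiff_exp
    by (intro bexI[of _ "\<lambda>x. \<i> * complex_of_real (y $ i) * exp (\<i> * complex_of_real (y \<bullet> x))"])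
      (auto intro!: exppoly.intros)
next
  case (add f g)
  then obtain f' g' where *: "f' \<in> exppoly X" "g' \<in> exppoly X"
    "\<And>x. (along f x i has_vector_derivative f' x) (at 0)"
    "\<And>x. (along g x i has_vector_derivative g' x) (at 0)" by blast
  have "(along (\<lambda>x. f x + g x) x i has_vector_derivative f' x + g' x) (at 0)" for x
    using has_vector_derivative_add[OF *(3,4)] by (simp add: along_def)
  then show ?case using *(1,2) by (intro bexI[of _ "\<lambda>x. f' x + g' x"]) (auto intro!: exppoly.intros)
next
  case (mult f g)
  then obtain f' g' where *: "f' \<in> exppoly X" "g' \<in> exppoly X"
    "\<And>x. (along f x i has_vector_derivative f' x) (at 0)"
    "\<And>x. (along g x i has_vector_derivative g' x) (at 0)" by blast
  have "(along (\<lambda>x. f x * g x) x i has_vector_derivative f x * g' x + f' x * g x) (at 0)" for x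
    using has_vector_derivative_mult[OF *(3,4)] by (simp add: along_def)
  then show ?case using *(1,2) mult.hyps
    by (intro bexI[of _ "\<lambda>x. f x * g' x + f' x * g x"]) (auto intro!: exppoly.intros)
qed

lemma pdiff_eqI:
  "(\<And>x. (along f x i has_vector_derivative g x) (at 0)) \<Longrightarrow> pdiff i f = g"
  by (auto simp: pdiff_def vector_derivative_at)

lemma exppoly_along:
  "f \<in> exppoly X \<Longrightarrow> (along f x i has_vector_derivative pdiff i f x) (at 0)"
  using exppoly_has_pdiff[of f X i] pdiff_eqI[of f i] by metis

lemma exppoly_pdiff: "f \<in> exppoly X \<Longrightarrow> pdiff i f \<in> exppoly X"
  using exppoly_has_pdiff[of f X i] pdiff_eqI[of f i] by metis

lemma pdiff_const: "pdiff i (\<lambda>_. c) = (\<lambda>_. 0)"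
  by (rule pdiff_eqI) (rule has_pdiff_const)

lemma pdiff_coord: "pdiff i (\<lambda>x. complex_of_real (x $ j)) = (\<lambda>_. if i = j then 1 else 0)"
  by (rule pdiff_eqI) (rule has_pdiff_coord)

lemma pdiff_exp:
  "pdiff i (\<lambda>x. exp (\<i> * complex_of_real (y \<bullet> x))) =
    (\<lambda>x. \<i> * complex_of_real (y $ i) * exp (\<i> * complex_of_real (y \<bullet> x)))"
  by (rule pdiff_eqI) (rule has_pdiff_exp)

lemma pdiff_add:
  assumes "f \<in> exppoly X" "g \<in> exppoly X"
  shows "pdiff i (\<lambda>x. f x + g x) = (\<lambda>x. pdiff i f x + pdiff i g x)"
proof (rule pdiff_eqI)
  fix x
  show "(along (\<lambda>x. f x + g x) x i has_vector_derivative (pdiff i f x + pdiff i g x)) (at 0)"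
    using has_vector_derivative_add[OF exppoly_along[OF assms(1), of x i] exppoly_along[OF assms(2), of x i]]
    by (simp add: along_def)
qed

lemma pdiff_mult:
  assumes "f \<in> exppoly X" "g \<in> exppoly X"
  shows "pdiff i (\<lambda>x. f x * g x) = (\<lambda>x. f x * pdiff i g x + pdiff i f x * g x)"
proof (rule pdiff_eqI)
  fix x
  show "(along (\<lambda>x. f x * g x) x i has_vector_derivative
      (f x * pdiff i g x + pdiff i f x * g x)) (at 0)"
    using has_vector_derivative_mult[OF exppoly_along[OF assms(1), of x i] exppoly_along[OF assms(2), of x i]]
    by (simp add: along_def)
qed

lemma pdiff_cmult:
  assumes "f \<in> exppoly X"
  shows "pdiff i (\<lambda>x. c * f x) = (\<lambda>x. c * pdiff i f x)"
  using pdiff_mult[OF const assms] by (simp add: pdiff_const)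

text \<open>On generators both orders are computed explicitly; for products the Leibniz rule applied
  twice gives an expression symmetric in \<open>i\<close> and \<open>j\<close> by the induction
  hypotheses.\<close>

lemma pdiff_commute:
  assumes "f \<in> exppoly X"
  shows "pdiff i (pdiff j f) = pdiff j (pdiff i f)"
  using assms
proof induction
  case (mult f g)
  then show ?case
    by (auto simp: pdiff_mult[of _ X] pdiff_add[of _ X] exppoly.mult exppoly_pdiff algebra_simps)
next
  case (exp y)
  then show ?case
    using exppoly.exp[OF exp]
    by (simp add: pdiff_exp mult.assoc pdiff_cmult[of _ X] exppoly.mult exppoly.const)
      (simp add: mult_ac)
qed (auto simp: pdiff_const pdiff_coord pdiff_add[of _ X] exppoly_pdiff)

lemma exppoly_cmult: "f \<in> exppoly X \<Longrightarrow> (\<lambda>x. c * f x) \<in> exppoly X"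
  by (intro exppoly.intros)

lemma exppoly_diff:
  assumes "f \<in> exppoly X" "g \<in> exppoly X"
  shows "(\<lambda>x. f x - g x) \<in> exppoly X"
  using exppoly.add[OF assms(1) exppoly_cmult[OF assms(2), of "-1"]] by simp

lemma exppoly_sum:
  "(\<And>t. t \<in> S \<Longrightarrow> f t \<in> exppoly X) \<Longrightarrow> (\<lambda>x. \<Sum>t\<in>S. f t x) \<in> exppoly X"
  by (induction S rule: infinite_finite_induct) (auto intro!: exppoly.intros)

lemma exppoly_prod:
  "(\<And>t. t \<in> S \<Longrightarrow> f t \<in> exppoly X) \<Longrightarrow> (\<lambda>x. \<Prod>t\<in>S. f t x) \<in> exppoly X"
  by (induction S rule: infinite_finite_induct) (auto intro!: exppoly.intros)

lemma exppoly_power: "f \<in> exppoly X \<Longrightarrow> (\<lambda>x. f x ^ n) \<in> exppoly X"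
  by (induction n) (auto intro!: exppoly.intros)

lemma exppoly_mpower: "(\<lambda>x. complex_of_real (mpower x \<mu>)) \<in> exppoly X"
  by (auto simp: mpower_def intro!: exppoly_prod exppoly_power exppoly.coord)

text \<open>The substitution replaces the frequency \<open>y\<close> by \<open>c y\<close> and turns
  the shift \<open>b\<close> into a constant phase. The closure condition on \<open>X\<close> holds
  trivially for the two instances of interest, \<open>{}\<close> and \<open>UNIV\<close>.\<close>

lemma exppoly_affine:
  assumes "f \<in> exppoly X" "\<And>y. y \<in> X \<Longrightarrow> c *\<^sub>R y \<in> X"
  shows "(\<lambda>x. f (c *\<^sub>R x + b)) \<in> exppoly X"
  using assms(1)
proof induction
  case (exp y)
  have "(\<lambda>x. exp (\<i> * complex_of_real (y \<bullet> (c *\<^sub>R x + b)))) =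
      (\<lambda>x. exp (\<i> * complex_of_real (y \<bullet> b)) * exp (\<i> * complex_of_real ((c *\<^sub>R y) \<bullet> x)))"
    by (simp add: inner_add_right exp_add[symmetric] algebra_simps)
  then show ?case
    by (simp only:) (intro exppoly.intros assms(2)[OF exp])
qed (auto intro!: exppoly.intros)

lemma exppoly_continuous: "f \<in> exppoly X \<Longrightarrow> continuous_on A f"
  by (induction rule: exppoly.induct) (auto intro!: continuous_intros)

lemma exppoly_Cm: "f \<in> exppoly X \<Longrightarrow> Cm m f"
proof (induction m arbitrary: f)
  case (Suc m)
  then show ?case
    using exppoly_along[OF Suc.prems]
    by (auto intro: exppoly_continuous differentiableI_vector exppoly_pdiff)
qed (auto intro: exppoly_continuous)

lemma pdiff_affine:
  assumes "f \<in> exppoly X"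
  shows "pdiff i (\<lambda>x. f (c *\<^sub>R x + b)) = (\<lambda>x. of_real c * pdiff i f (c *\<^sub>R x + b))"
proof (rule pdiff_eqI)
  fix x
  have "((\<lambda>t. c * t) has_vector_derivative c) (at 0)"
    by (auto intro!: derivative_eq_intros)
  moreover have "(along f (c *\<^sub>R x + b) i has_vector_derivative pdiff i f (c *\<^sub>R x + b)) (at (c * 0))"
    using exppoly_along[OF assms] by simp
  ultimately have "(along f (c *\<^sub>R x + b) i \<circ> (\<lambda>t. c * t) has_vector_derivative
      c *\<^sub>R pdiff i f (c *\<^sub>R x + b)) (at 0)"
    by (rule vector_diff_chain_at)
  then show "(along (\<lambda>x. f (c *\<^sub>R x + b)) x i has_vector_derivative
      of_real c * pdiff i f (c *\<^sub>R x + b)) (at 0)"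
    by (simp add: along_def o_def algebra_simps scaleR_conv_of_real)
qed

section \<open>Multi-indices, monomials and finite boxes\<close>

lemma mabs_0 [simp]: "mabs 0 = 0"
  by (simp add: mabs_def)

lemma mabs_add_axis [simp]: "mabs (\<mu> + axis i 1) = Suc (mabs \<mu>)"
  by (simp add: mabs_def axis_def sum.distrib)

lemma mpower_0 [simp]: "mpower x 0 = 1"
  by (simp add: mpower_def)

lemma mpower_add_axis: "mpower x (\<mu> + axis i 1) = x $ i * mpower x \<mu>"
proof -
  have "x $ j ^ (\<mu> + axis i 1) $ j = (if j = i then x $ i else 1) * x $ j ^ \<mu> $ j" for j
    by (auto simp: axis_def power_add)
  then show ?thesis
    by (simp add: mpower_def prod.distrib)
qed

lemma mpower_zero: "mpower 0 \<mu> = (if \<mu> = 0 then 1 else 0)"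
  by (auto simp: mpower_def vec_eq_iff power_0_left)

lemma mpower_scaleR: "mpower (c *\<^sub>R x) \<mu> = c ^ mabs \<mu> * mpower x \<mu>"
  by (simp add: mpower_def mabs_def power_mult_distrib prod.distrib power_sum)

text \<open>Adding one unit multi-index at a time matches the recursion of \<open>mdiff\<close> and
  of \<open>mpower\<close>, which replaces binomial expansions by one-step product rules.\<close>

lemma multiindex_induct [case_names 0 Suc]:
  fixes \<mu> :: "'d::finite multiindex"
  assumes "P 0" "\<And>\<mu> i. P \<mu> \<Longrightarrow> P (\<mu> + axis i 1)"
  shows "P \<mu>"
proof (induction "mabs \<mu>" arbitrary: \<mu>)
  case 0
  then have "\<mu> = 0" by (simp add: mabs_def vec_eq_iff)
  then show ?case using assms(1) by simp
next
  case (Suc n)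
  then obtain i where i: "\<mu> $ i \<noteq> 0"
    by (metis mabs_def sum.neutral nat.distinct(1))
  define \<mu>' where "\<mu>' = \<mu> - axis i 1"
  have *: "\<mu> = \<mu>' + axis i 1"
    using i by (auto simp: \<mu>'_def vec_eq_iff axis_def)
  then have "n = mabs \<mu>'"
    using Suc(2) by simp
  from assms(2)[OF Suc(1)[OF this]] show ?case
    by (simp only: *)
qed

lemma finite_vec_set:
  assumes "\<And>i. finite (S i)"
  shows "finite {k :: 'b ^ 'd::finite. \<forall>i. k $ i \<in> S i}"
proof -
  have "{k :: 'b ^ 'd. \<forall>i. k $ i \<in> S i} \<subseteq> vec_lambda ` Pi\<^sub>E UNIV S"
  proof
    fix k :: "'b ^ 'd" assume "k \<in> {k. \<forall>i. k $ i \<in> S i}"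
    then show "k \<in> vec_lambda ` Pi\<^sub>E UNIV S"
      by (intro image_eqI[of _ _ "vec_nth k"]) auto
  qed
  then show ?thesis
    by (rule finite_subset) (use assms in \<open>simp add: finite_PiE\<close>)
qed

text \<open>Distributivity over a box of vectors. It factors both the character sums on the cube
  {0,1}^d and the tensor product Lagrange interpolation into one-dimensional sums.\<close>

lemma sum_prod_vec:
  fixes f :: "'d::finite \<Rightarrow> 'b \<Rightarrow> 'c::comm_semiring_1"
  assumes "finite S"
  shows "(\<Sum>k | \<forall>i. k $ i \<in> S. \<Prod>i\<in>UNIV. f i (k $ i)) = (\<Prod>i\<in>UNIV. \<Sum>s\<in>S. f i s)"
proof -
  have "{k :: 'b ^ 'd. \<forall>i. k $ i \<in> S} = vec_lambda ` Pi\<^sub>E UNIV (\<lambda>_. S)" (is "?A = ?B")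
  proof (intro equalityI subsetI)
    fix k assume "k \<in> ?A"
    then show "k \<in> ?B"
      by (intro image_eqI[of _ _ "vec_nth k"]) auto
  qed auto
  moreover have "inj_on vec_lambda (Pi\<^sub>E UNIV (\<lambda>_::'d. S))"
    by (auto simp: inj_on_def vec_lambda_inject)
  ultimately show ?thesis
    using assms by (simp add: sum.reindex prod_sum_PiE)
qed

lemma finite_multiindex: "finite {\<mu> :: 'd::finite multiindex. mabs \<mu> \<le> M}"
proof (rule finite_subset)
  show "{\<mu> :: 'd multiindex. mabs \<mu> \<le> M} \<subseteq> {\<mu>. \<forall>i. \<mu> $ i \<in> {..M}}"
  proof
    fix \<mu> :: "'d multiindex" assume "\<mu> \<in> {\<mu>. mabs \<mu> \<le> M}"
    moreover have "\<mu> $ i \<le> mabs \<mu>" for i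
      unfolding mabs_def by (rule member_le_sum) auto
    ultimately show "\<mu> \<in> {\<mu>. \<forall>i. \<mu> $ i \<in> {..M}}"
      by (auto intro: order_trans)
  qed
qed (rule finite_vec_set, rule finite_atMost)

section \<open>Derivatives of multi-index order\<close>

lemma exppoly_pdiff_funpow: "f \<in> exppoly X \<Longrightarrow> (pdiff i ^^ n) f \<in> exppoly X"
  by (induction n) (auto intro: exppoly_pdiff)

lemma pdiff_funpow_commute:
  "f \<in> exppoly X \<Longrightarrow> pdiff j ((pdiff i ^^ n) f) = (pdiff i ^^ n) (pdiff j f)"
  by (induction n) (auto simp: pdiff_commute[OF exppoly_pdiff_funpow])

lemma exppoly_foldr_pdiff:
  "f \<in> exppoly X \<Longrightarrow> foldr (\<lambda>i. pdiff i ^^ \<mu> i) L f \<in> exppoly X"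
  by (induction L) (auto simp: exppoly_pdiff_funpow)

lemma pdiff_foldr_commute:
  "f \<in> exppoly X \<Longrightarrow>
    pdiff j (foldr (\<lambda>i. pdiff i ^^ \<mu> i) L f) = foldr (\<lambda>i. pdiff i ^^ \<mu> i) L (pdiff j f)"
  by (induction L) (auto simp: pdiff_funpow_commute[OF exppoly_foldr_pdiff])

text \<open>Distinctness means that \<open>j\<close> occurs once in the list, so exactly one block
  gains a derivative; commutation carries it past the blocks standing before it.\<close>

lemma foldr_pdiff_add_axis:
  assumes "f \<in> exppoly X" "distinct L" "j \<in> set L"
  shows "foldr (\<lambda>i. pdiff i ^^ ((\<mu> + axis j 1) $ i)) L f =
      pdiff j (foldr (\<lambda>i. pdiff i ^^ (\<mu> $ i)) L f)"
  using assms(2,3)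
proof (induction L)
  case (Cons i L)
  show ?case
  proof (cases "i = j")
    case True
    then have "foldr (\<lambda>i. pdiff i ^^ ((\<mu> + axis j 1) $ i)) L f = foldr (\<lambda>i. pdiff i ^^ (\<mu> $ i)) L f"
      using Cons.prems by (intro foldr_cong) (auto simp: axis_def)
    then show ?thesis using True by (simp add: Suc_eq_plus1[symmetric])
  next
    case False
    then show ?thesis
      using Cons pdiff_funpow_commute[OF exppoly_foldr_pdiff[OF assms(1)]] by (simp add: axis_def)
  qed
qed auto

lemma mdiff_0 [simp]: "mdiff 0 f = f"
proof -
  have "foldr (\<lambda>i. pdiff i ^^ ((0::'a multiindex) $ i)) L f = f" for L
    by (induction L) auto
  then show ?thesis by (simp add: mdiff_def)
qed

lemma exppoly_mdiff: "f \<in> exppoly X \<Longrightarrow> mdiff \<mu> f \<in> exppoly X"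
  unfolding mdiff_def by (rule exppoly_foldr_pdiff)

lemma mdiff_Suc: "f \<in> exppoly X \<Longrightarrow> mdiff (\<mu> + axis i 1) f = pdiff i (mdiff \<mu> f)"
  unfolding mdiff_def by (rule foldr_pdiff_add_axis) auto

text \<open>The innermost form complements \<open>mdiff_Suc\<close>: it is the one to use when
  \<open>pdiff i f\<close> is known explicitly, and in inductions on the order of a jet.\<close>

lemma mdiff_Suc': "f \<in> exppoly X \<Longrightarrow> mdiff (\<mu> + axis i 1) f = mdiff \<mu> (pdiff i f)"
  by (simp add: mdiff_Suc) (simp add: mdiff_def pdiff_foldr_commute)

lemma mdiff_add:
  assumes "f \<in> exppoly X" "g \<in> exppoly X"
  shows "mdiff \<mu> (\<lambda>x. f x + g x) = (\<lambda>x. mdiff \<mu> f x + mdiff \<mu> g x)"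
proof (induction \<mu> rule: multiindex_induct)
  case (Suc \<mu> i)
  then show ?case using assms
    by (simp add: mdiff_Suc[of _ X] exppoly.add pdiff_add[of _ X] exppoly_mdiff)
qed simp

lemma mdiff_cmult:
  assumes "f \<in> exppoly X"
  shows "mdiff \<mu> (\<lambda>x. c * f x) = (\<lambda>x. c * mdiff \<mu> f x)"
proof (induction \<mu> rule: multiindex_induct)
  case (Suc \<mu> i)
  then show ?case using assms
    by (simp add: mdiff_Suc[of _ X] exppoly_cmult pdiff_cmult[of _ X] exppoly_mdiff)
qed simp

lemma mdiff_const: "mdiff \<mu> (\<lambda>_. c :: complex) = (\<lambda>_. if \<mu> = 0 then c else 0)"
proof (induction \<mu> rule: multiindex_induct)
  case (Suc \<mu> i)
  have "\<mu> + axis i 1 \<noteq> 0" by (metis mabs_0 mabs_add_axis nat.distinct(1))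
  then show ?case using Suc
    by (simp add: mdiff_Suc[of _ "{}"] const pdiff_const)
qed simp

lemma mdiff_sum:
  assumes "\<And>t. t \<in> S \<Longrightarrow> f t \<in> exppoly X"
  shows "mdiff \<mu> (\<lambda>x. \<Sum>t\<in>S. f t x) = (\<lambda>x. \<Sum>t\<in>S. mdiff \<mu> (f t) x)"
  using assms
proof (induction S rule: infinite_finite_induct)
  case (insert t S)
  then show ?case by (simp add: mdiff_add[of _ X] exppoly_sum)
qed (auto simp: mdiff_const)

lemma mdiff_affine:
  assumes "f \<in> exppoly X" "\<And>y. y \<in> X \<Longrightarrow> c *\<^sub>R y \<in> X"
  shows "mdiff \<mu> (\<lambda>x. f (c *\<^sub>R x + b)) = (\<lambda>x. of_real c ^ mabs \<mu> * mdiff \<mu> f (c *\<^sub>R x + b))"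
proof (induction \<mu> rule: multiindex_induct)
  case (Suc \<mu> i)
  have "(\<lambda>x. f (c *\<^sub>R x + b)) \<in> exppoly X"
    by (rule exppoly_affine[OF assms])
  from mdiff_Suc[OF this] have "mdiff (\<mu> + axis i 1) (\<lambda>x. f (c *\<^sub>R x + b)) =
      pdiff i (\<lambda>x. of_real c ^ mabs \<mu> * mdiff \<mu> f (c *\<^sub>R x + b))"
    by (simp only: Suc.IH)
  also have "\<dots> = (\<lambda>x. of_real c ^ mabs \<mu> * (of_real c * pdiff i (mdiff \<mu> f) (c *\<^sub>R x + b)))"
    using assms by (simp add: pdiff_cmult[OF exppoly_affine[OF exppoly_mdiff]]
      pdiff_affine[OF exppoly_mdiff])
  finally show ?case using assms(1) by (simp add: mdiff_Suc mult_ac)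
qed simp

lemma mdiff_scale:
  assumes "f \<in> exppoly X" "\<And>y. y \<in> X \<Longrightarrow> c *\<^sub>R y \<in> X"
  shows "mdiff \<mu> (\<lambda>x. f (c *\<^sub>R x)) x = of_real c ^ mabs \<mu> * mdiff \<mu> f (c *\<^sub>R x)"
  using mdiff_affine[OF assms, of \<mu> 0] by simp

text \<open>Index bookkeeping common to the product rules for \<open>x $ j * f\<close> and for
  \<open>hexp\<close>. Subtraction on naturals is truncated, but where
  \<open>\<alpha> $ j = 0\<close> the coefficient removes the meaningless term.\<close>

lemma multiindex_diff_axis:
  fixes \<alpha> :: "'d::finite multiindex"
  shows "of_nat (\<alpha> $ j) * F (\<alpha> - axis j 1 + axis i 1) + (if i = j then 1 else 0) * F \<alpha> =
    (of_nat ((\<alpha> + axis i 1) $ j) * F (\<alpha> + axis i 1 - axis j 1) :: complex)"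
proof -
  have "\<alpha> - axis j 1 + axis i 1 = \<alpha> + axis i 1 - axis j 1" if "\<alpha> $ j \<noteq> 0"
    using that by (auto simp: vec_eq_iff axis_def)
  moreover have "\<alpha> + axis i 1 - axis i 1 = \<alpha>"
    by (auto simp: vec_eq_iff)
  ultimately show ?thesis
    by (cases "\<alpha> $ j = 0"; cases "i = j") (auto simp: algebra_simps axis_def)
qed

text \<open>The Leibniz rule stops after two terms because the second derivatives of a coordinate
  vanish.\<close>

lemma mdiff_coord_mult:
  assumes "f \<in> exppoly X"
  shows "mdiff \<alpha> (\<lambda>x. complex_of_real (x $ j) * f x) =
    (\<lambda>x. complex_of_real (x $ j) * mdiff \<alpha> f x + of_nat (\<alpha> $ j) * mdiff (\<alpha> - axis j 1) f x)"
proof (induction \<alpha> rule: multiindex_induct)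
  case (Suc \<alpha> i)
  have *: "(\<lambda>x. complex_of_real (x $ j) * f x) \<in> exppoly X"
    using assms by (intro exppoly.intros)
  show ?case
  proof
    fix x
    have "mdiff (\<alpha> + axis i 1) (\<lambda>x. complex_of_real (x $ j) * f x) x =
       complex_of_real (x $ j) * pdiff i (mdiff \<alpha> f) x + (if i = j then 1 else 0) * mdiff \<alpha> f x
       + of_nat (\<alpha> $ j) * pdiff i (mdiff (\<alpha> - axis j 1) f) x"
      unfolding mdiff_Suc[OF *] Suc.IH using assms
      by (simp add: pdiff_add[of _ X] pdiff_mult[of _ X] pdiff_cmult[of _ X] pdiff_coord
        exppoly_cmult exppoly_mdiff exppoly.mult exppoly.coord pdiff_const exppoly.const)
    then show "mdiff (\<alpha> + axis i 1) (\<lambda>x. complex_of_real (x $ j) * f x) x =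
        complex_of_real (x $ j) * mdiff (\<alpha> + axis i 1) f x
        + of_nat ((\<alpha> + axis i 1) $ j) * mdiff (\<alpha> + axis i 1 - axis j 1) f x"
      unfolding multiindex_diff_axis[of \<alpha> j "\<lambda>\<beta>. mdiff \<beta> f x" i, symmetric]
      by (simp add: mdiff_Suc[OF assms])
  qed
qed simp

section \<open>Jets of the target functions\<close>

definition hexp :: "'d::finite multiindex \<Rightarrow> 'd rvec \<Rightarrow> 'd rvec \<Rightarrow> complex" where
  "hexp \<alpha> y \<xi> = \<i> ^ mabs \<alpha> * complex_of_real (mpower \<xi> \<alpha>) * exp (\<i> * complex_of_real (y \<bullet> \<xi>))"

lemma exppoly_hexp: "hexp \<alpha> y \<in> exppoly UNIV"
  unfolding hexp_def[abs_def] by (auto intro!: exppoly.intros exppoly_mpower)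

lemma hexp_Suc: "hexp (\<alpha> + axis i 1) y = (\<lambda>\<xi>. \<i> * (complex_of_real (\<xi> $ i) * hexp \<alpha> y \<xi>))"
  by (auto simp: hexp_def mpower_add_axis)

text \<open>Lowering \<alpha> by one unit loses one power of \<open>\<i>\<close> in
  \<open>hexp\<close>; this is why \<open>\<i>\<close> can be taken out of both terms.\<close>

lemma pdiff_hexp:
  "pdiff j (hexp \<alpha> y) =
    (\<lambda>\<xi>. \<i> * (of_nat (\<alpha> $ j) * hexp (\<alpha> - axis j 1) y \<xi> + complex_of_real (y $ j) * hexp \<alpha> y \<xi>))"
proof (induction \<alpha> rule: multiindex_induct)
  case 0
  show ?case by (simp add: hexp_def[abs_def] pdiff_exp mult.assoc)
next
  case (Suc \<alpha> i)
  show ?case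
  proof
    fix \<xi>
    have "pdiff j (hexp (\<alpha> + axis i 1) y) \<xi> =
        \<i> * (complex_of_real (\<xi> $ i) * pdiff j (hexp \<alpha> y) \<xi> + (if j = i then 1 else 0) * hexp \<alpha> y \<xi>)"
      unfolding hexp_Suc
      by (simp add: pdiff_mult[of _ UNIV] pdiff_cmult[of _ UNIV] pdiff_coord
        exppoly_hexp exppoly.mult exppoly.coord)
    also have "\<dots> = \<i> * ((of_nat (\<alpha> $ j) * hexp (\<alpha> - axis j 1 + axis i 1) y \<xi>
        + (if i = j then 1 else 0) * hexp \<alpha> y \<xi>)
        + complex_of_real (y $ j) * hexp (\<alpha> + axis i 1) y \<xi>)"
      unfolding Suc.IH hexp_Suc by (auto simp: algebra_simps)
    finally show "pdiff j (hexp (\<alpha> + axis i 1) y) \<xi> =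
        \<i> * (of_nat ((\<alpha> + axis i 1) $ j) * hexp (\<alpha> + axis i 1 - axis j 1) y \<xi>
          + complex_of_real (y $ j) * hexp (\<alpha> + axis i 1) y \<xi>)"
      unfolding multiindex_diff_axis[of \<alpha> j "\<lambda>\<beta>. hexp \<beta> y \<xi>" i] .
  qed
qed

text \<open>Up to the power of \<open>\<i>\<close>, both sides obey the same recursion in \<mu>: on
  the left it is \<open>pdiff_hexp\<close>, on the right the rule for multiplying a monomial by a
  coordinate. As the recursion lowers \<alpha>, that index stays arbitrary in the induction.\<close>

lemma mdiff_hexp:
  "mdiff \<mu> (hexp \<alpha> y) 0 = \<i> ^ mabs \<mu> * mdiff \<alpha> (\<lambda>x. complex_of_real (mpower x \<mu>)) y"
proof (induction \<mu> arbitrary: \<alpha> rule: multiindex_induct)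
  case 0
  then show ?case by (auto simp: hexp_def mpower_zero mdiff_const)
next
  case (Suc \<mu> j)
  have *: "(\<lambda>x. complex_of_real (mpower x \<mu>)) \<in> exppoly {}"
    by (rule exppoly_mpower)
  have "mdiff (\<mu> + axis j 1) (hexp \<alpha> y) 0 =
     \<i> * (of_nat (\<alpha> $ j) * mdiff \<mu> (hexp (\<alpha> - axis j 1) y) 0 + complex_of_real (y $ j) * mdiff \<mu> (hexp \<alpha> y) 0)"
    unfolding mdiff_Suc'[OF exppoly_hexp] pdiff_hexp
    by (simp add: mdiff_add[of _ UNIV] mdiff_cmult[of _ UNIV] exppoly_hexp exppoly.add exppoly_cmult)
  then show ?case
    unfolding Suc.IH mpower_add_axis of_real_mult mdiff_coord_mult[OF *]
    by (simp add: algebra_simps)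
qed

lemma mdiff_minus:
  assumes "f \<in> exppoly X" "g \<in> exppoly X"
  shows "mdiff \<mu> (\<lambda>x. f x - g x) = (\<lambda>x. mdiff \<mu> f x - mdiff \<mu> g x)"
  using mdiff_add[OF assms(1) exppoly_cmult[OF assms(2), of "-1"], of \<mu>] mdiff_cmult[OF assms(2), of \<mu> "-1"]
  by simp

section \<open>Agreement of jets at the origin\<close>

lemma has_vector_derivative_vec:
  fixes f :: "real \<Rightarrow> ('a::real_normed_vector) ^ 'n"
  assumes "\<And>i. ((\<lambda>t. f t $ i) has_vector_derivative D $ i) (at x)"
  shows "(f has_vector_derivative D) (at x)"
  unfolding has_vector_derivative_def has_derivative_at_within
proof
  show "bounded_linear (\<lambda>h. h *\<^sub>R D)"
    by (rule bounded_linear_scaleR_left)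
  show "((\<lambda>y. (f y - f x - (y - x) *\<^sub>R D) /\<^sub>R norm (y - x)) \<longlongrightarrow> 0) (at x)"
    using assms unfolding has_vector_derivative_def has_derivative_at_within
    by (intro vec_tendstoI) simp
qed

lemma pdiff_vec:
  fixes f :: "'d::finite rvec \<Rightarrow> complex ^ 'b::finite ^ 'a::finite"
  assumes "\<And>a b. (\<lambda>x. f x $ a $ b) \<in> exppoly X"
  shows "pdiff i f = (\<lambda>x. \<chi> a b. pdiff i (\<lambda>x. f x $ a $ b) x)"
proof (rule pdiff_eqI)
  fix x
  show "(along f x i has_vector_derivative (\<chi> a b. pdiff i (\<lambda>x. f x $ a $ b) x)) (at 0)"
  proof (intro has_vector_derivative_vec)
    fix a b
    show "((\<lambda>t. along f x i t $ a $ b) has_vector_derivative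
        (\<chi> a b. pdiff i (\<lambda>x. f x $ a $ b) x) $ a $ b) (at 0)"
      using exppoly_along[of "\<lambda>x. f x $ a $ b" X x i] assms by (simp add: along_def)
  qed
qed

lemma pdiff_funpow_vec:
  fixes f :: "'d::finite rvec \<Rightarrow> complex ^ 'b::finite ^ 'a::finite"
  assumes "\<And>a b. (\<lambda>x. f x $ a $ b) \<in> exppoly X"
  shows "(pdiff i ^^ n) f = (\<lambda>x. \<chi> a b. (pdiff i ^^ n) (\<lambda>x. f x $ a $ b) x)"
proof (induction n)
  case (Suc n)
  then show ?case
    using exppoly_pdiff_funpow[OF assms] by (simp add: pdiff_vec[of _ X])
qed simp

lemma foldr_pdiff_vec:
  fixes f :: "'d::finite rvec \<Rightarrow> complex ^ 'b::finite ^ 'a::finite"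
  assumes "\<And>a b. (\<lambda>x. f x $ a $ b) \<in> exppoly X"
  shows "foldr (\<lambda>i. pdiff i ^^ \<mu> i) L f =
    (\<lambda>x. \<chi> a b. foldr (\<lambda>i. pdiff i ^^ \<mu> i) L (\<lambda>x. f x $ a $ b) x)"
proof (induction L)
  case (Cons i L)
  then show ?case
    using exppoly_foldr_pdiff[OF assms] by (simp add: pdiff_funpow_vec[of _ X])
qed simp

lemma mdiff_vec:
  fixes f :: "'d::{finite,linorder} rvec \<Rightarrow> complex ^ 'b::finite ^ 'a::finite"
  assumes "\<And>a b. (\<lambda>x. f x $ a $ b) \<in> exppoly X"
  shows "mdiff \<mu> f x $ a $ b = mdiff \<mu> (\<lambda>x. f x $ a $ b) x"
  unfolding mdiff_def by (simp add: foldr_pdiff_vec[OF assms])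

text \<open>The sum rules compare matrix-valued functions, while the calculus of
  \<open>exppoly\<close> is scalar; this lemma passes between the two.\<close>

lemma eq_upto_O_vec:
  fixes f g :: "'d::{finite,linorder} rvec \<Rightarrow> complex ^ 'b::finite ^ 'a::finite"
  assumes "\<And>a b. (\<lambda>x. f x $ a $ b) \<in> exppoly X" "\<And>a b. (\<lambda>x. g x $ a $ b) \<in> exppoly X"
  shows "eq_upto_O N f g \<longleftrightarrow> (\<forall>a b. eq_upto_O N (\<lambda>x. f x $ a $ b) (\<lambda>x. g x $ a $ b))"
  unfolding eq_upto_O_def vec_eq_iff mdiff_vec[OF assms(1)] mdiff_vec[OF assms(2)] by blast

lemma eq_upto_O_refl: "eq_upto_O N f f"
  by (simp add: eq_upto_O_def)

lemma eq_upto_O_cong: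
  "eq_upto_O N f f' \<Longrightarrow> eq_upto_O N g g' \<Longrightarrow> eq_upto_O N f g \<longleftrightarrow> eq_upto_O N f' g'"
  by (simp add: eq_upto_O_def)

lemma eq_upto_O_minus:
  assumes "f \<in> exppoly X" "g \<in> exppoly X"
  shows "eq_upto_O N f g \<longleftrightarrow> eq_upto_O N (\<lambda>x. f x - g x) (\<lambda>_. 0)"
  by (simp add: eq_upto_O_def mdiff_minus[OF assms] mdiff_const)

text \<open>A recursive description of vanishing to a given order, which allows induction on the
  order without the general Leibniz formula.\<close>

lemma eq_upto_O_Suc:
  assumes "f \<in> exppoly X"
  shows "eq_upto_O (Suc N) f (\<lambda>_. 0) \<longleftrightarrow> f 0 = 0 \<and> (\<forall>i. eq_upto_O N (pdiff i f) (\<lambda>_. 0))"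
proof
  assume L: "eq_upto_O (Suc N) f (\<lambda>_. 0)"
  have "mdiff 0 f 0 = mdiff 0 (\<lambda>_. 0) (0 :: 'a rvec)"
    using L unfolding eq_upto_O_def by (metis mabs_0 zero_less_Suc)
  moreover have "mdiff \<mu> (pdiff i f) 0 = 0" if "mabs \<mu> < N" for i \<mu>
    using L that unfolding eq_upto_O_def mdiff_Suc'[OF assms, symmetric]
    by (simp add: mdiff_const)
  ultimately show "f 0 = 0 \<and> (\<forall>i. eq_upto_O N (pdiff i f) (\<lambda>_. 0))"
    by (simp add: eq_upto_O_def mdiff_const)
next
  assume R: "f 0 = 0 \<and> (\<forall>i. eq_upto_O N (pdiff i f) (\<lambda>_. 0))"
  have "mabs \<mu> < Suc N \<longrightarrow> mdiff \<mu> f 0 = 0" for \<mu>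
  proof (induction \<mu> rule: multiindex_induct)
    case (Suc \<mu> i)
    then show ?case
      using R by (simp add: mdiff_Suc'[OF assms] eq_upto_O_def mdiff_const)
  qed (use R in simp)
  then show "eq_upto_O (Suc N) f (\<lambda>_. 0)"
    by (simp add: eq_upto_O_def mdiff_const)
qed

lemma eq_upto_O_add:
  assumes "f \<in> exppoly X" "g \<in> exppoly X" "f' \<in> exppoly X" "g' \<in> exppoly X"
    and "eq_upto_O N f f'" "eq_upto_O N g g'"
  shows "eq_upto_O N (\<lambda>x. f x + g x) (\<lambda>x. f' x + g' x)"
  using assms by (simp add: eq_upto_O_def mdiff_add[of _ X])

lemma eq_upto_O_sum:
  assumes "\<And>t. t \<in> S \<Longrightarrow> f t \<in> exppoly X" "\<And>t. t \<in> S \<Longrightarrow> g t \<in> exppoly X"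
    and "\<And>t. t \<in> S \<Longrightarrow> eq_upto_O N (f t) (g t)"
  shows "eq_upto_O N (\<lambda>x. \<Sum>t\<in>S. f t x) (\<lambda>x. \<Sum>t\<in>S. g t x)"
  using assms by (simp add: eq_upto_O_def mdiff_sum[of _ _ X])

text \<open>Functions vanishing to order \<open>N\<close> form an ideal. In the induction step,
  \<open>f * pdiff i g\<close> is covered because \<open>f\<close> also vanishes to the lower order,
  and \<open>pdiff i f * g\<close> because differentiation costs one order.\<close>

lemma eq_upto_O_zero_mult:
  assumes "f \<in> exppoly X" "g \<in> exppoly X" "eq_upto_O N f (\<lambda>_. 0)"
  shows "eq_upto_O N (\<lambda>x. f x * g x) (\<lambda>_. 0)"
  using assms
proof (induction N arbitrary: f g)
  case 0
  then show ?case by (simp add: eq_upto_O_def)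
next
  case (Suc N)
  have f: "f 0 = 0" "\<And>i. eq_upto_O N (pdiff i f) (\<lambda>_. 0)"
    using Suc.prems eq_upto_O_Suc by blast+
  have "eq_upto_O N f (\<lambda>_. 0)"
    using Suc.prems(3) by (simp add: eq_upto_O_def)
  note IH = Suc.IH[OF Suc.prems(1) exppoly_pdiff[OF Suc.prems(2)] this]
    Suc.IH[OF exppoly_pdiff[OF Suc.prems(1)] Suc.prems(2) f(2)]
  have "eq_upto_O N (\<lambda>x. f x * pdiff i g x + pdiff i f x * g x) (\<lambda>x. 0 + 0)" for i
    using Suc.prems(1,2) IH by (intro eq_upto_O_add[of _ X] exppoly.intros exppoly_pdiff)
  then have "eq_upto_O N (pdiff i (\<lambda>x. f x * g x)) (\<lambda>_. 0)" for i
    unfolding pdiff_mult[OF Suc.prems(1,2)] by simp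
  then show ?case
    using f(1) by (subst eq_upto_O_Suc[OF exppoly.mult[OF Suc.prems(1,2)]]) simp
qed

lemma eq_upto_O_mult_right:
  assumes "f \<in> exppoly X" "f' \<in> exppoly X" "g \<in> exppoly X" "eq_upto_O N f f'"
  shows "eq_upto_O N (\<lambda>x. f x * g x) (\<lambda>x. f' x * g x)"
proof -
  have "eq_upto_O N (\<lambda>x. (f x - f' x) * g x) (\<lambda>_. 0)"
    using assms by (intro eq_upto_O_zero_mult[of _ X])
      (auto intro: exppoly_diff simp: eq_upto_O_minus[of f X f'])
  then show ?thesis
    using assms by (simp add: eq_upto_O_minus[of _ X] exppoly.mult left_diff_distrib)
qed

lemma eq_upto_O_mult_left:
  assumes "f \<in> exppoly X" "f' \<in> exppoly X" "g \<in> exppoly X" "eq_upto_O N f f'"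
  shows "eq_upto_O N (\<lambda>x. g x * f x) (\<lambda>x. g x * f' x)"
  using eq_upto_O_mult_right[OF assms] by (simp add: mult.commute)

lemma eq_upto_O_lincomb:
  assumes "\<And>t. t \<in> S \<Longrightarrow> f t \<in> exppoly X" "\<And>t. t \<in> S \<Longrightarrow> g t \<in> exppoly X"
    and "\<And>t. t \<in> S \<Longrightarrow> eq_upto_O N (f t) (g t)"
  shows "eq_upto_O N (\<lambda>x. \<Sum>t\<in>S. c t * f t x) (\<lambda>x. \<Sum>t\<in>S. c t * g t x)"
  using assms
  by (intro eq_upto_O_sum[of _ _ X] eq_upto_O_mult_left[of _ X] exppoly_cmult exppoly.const)

lemma eq_upto_O_scale:
  assumes "f \<in> exppoly UNIV" "g \<in> exppoly UNIV" "eq_upto_O N f g"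
  shows "eq_upto_O N (\<lambda>x. f (c *\<^sub>R x)) (\<lambda>x. g (c *\<^sub>R x))"
  using assms by (simp add: eq_upto_O_def mdiff_scale)

text \<open>An exponential is a unit, so multiplication by the one with frequency \<open>-y\<close>
  undoes the modulation.\<close>

lemma eq_upto_O_mult_exp_iff:
  assumes "f \<in> exppoly UNIV" "g \<in> exppoly UNIV"
  shows "eq_upto_O N (\<lambda>x. f x * exp (\<i> * complex_of_real (y \<bullet> x)))
      (\<lambda>x. g x * exp (\<i> * complex_of_real (y \<bullet> x))) \<longleftrightarrow> eq_upto_O N f g"
    (is "eq_upto_O N ?F ?G \<longleftrightarrow> _")
proof
  have *: "?F \<in> exppoly UNIV" "?G \<in> exppoly UNIV"
    using assms by (auto intro!: exppoly.intros)
  assume "eq_upto_O N ?F ?G"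
  from eq_upto_O_mult_right[OF * exppoly.exp[OF UNIV_I] this, of "-y"]
  show "eq_upto_O N f g"
    by (simp add: mult.assoc exp_add[symmetric])
next
  assume "eq_upto_O N f g"
  from eq_upto_O_mult_right[OF assms exppoly.exp[OF UNIV_I] this, of y]
  show "eq_upto_O N ?F ?G" .
qed

section \<open>Polynomials\<close>

lemma polysI:
  "p = (\<lambda>x. \<Sum>\<mu> | mabs \<mu> \<le> N. c \<mu> * complex_of_real (mpower x \<mu>)) \<Longrightarrow> p \<in> polys N"
  unfolding polys_def by blast

lemma polys_monomial:
  fixes \<mu> :: "'d::finite multiindex"
  assumes "mabs \<mu> \<le> N"
  shows "(\<lambda>x. c * complex_of_real (mpower x \<mu>)) \<in> polys N"
proof -
  have "c * complex_of_real (mpower x \<mu>) =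
      (\<Sum>\<kappa> | mabs \<kappa> \<le> N. (if \<kappa> = \<mu> then c else 0) * complex_of_real (mpower x \<kappa>))" for x
  proof -
    have "(\<Sum>\<kappa> | mabs \<kappa> \<le> N. (if \<kappa> = \<mu> then c else 0) * complex_of_real (mpower x \<kappa>)) =
      (\<Sum>\<kappa> | mabs \<kappa> \<le> N. if \<kappa> = \<mu> then c * complex_of_real (mpower x \<mu>) else 0)"
      by (rule sum.cong) auto
    also have "\<dots> = c * complex_of_real (mpower x \<mu>)"
      using assms by (subst sum.delta[OF finite_multiindex]) simp
    finally show ?thesis ..
  qed
  then show ?thesis by (intro polysI) fastforce
qed

lemma polys_add:
  assumes "p \<in> polys N" "q \<in> polys N"
  shows "(\<lambda>x. p x + q x) \<in> polys N"
proof -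
  obtain c d where "p = (\<lambda>x. \<Sum>\<mu> | mabs \<mu> \<le> N. c \<mu> * complex_of_real (mpower x \<mu>))"
    "q = (\<lambda>x. \<Sum>\<mu> | mabs \<mu> \<le> N. d \<mu> * complex_of_real (mpower x \<mu>))"
    using assms unfolding polys_def by blast
  then have "(\<lambda>x. p x + q x) = (\<lambda>x. \<Sum>\<mu> | mabs \<mu> \<le> N. (c \<mu> + d \<mu>) * complex_of_real (mpower x \<mu>))"
    by (simp add: distrib_right sum.distrib)
  then show ?thesis by (intro polysI) fastforce
qed

lemma polys_sum:
  assumes "\<And>t. t \<in> S \<Longrightarrow> p t \<in> polys N"
  shows "(\<lambda>x. \<Sum>t\<in>S. p t x) \<in> polys N"
proof -
  have "(\<lambda>_. 0) \<in> polys N"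
    using polys_monomial[of 0 N 0] by simp
  with assms show ?thesis
    by (induction S rule: infinite_finite_induct) (auto intro: polys_add)
qed

lemma polysE:
  assumes "p \<in> polys N"
  obtains c where "p = (\<lambda>x. \<Sum>\<mu> | mabs \<mu> \<le> N. c \<mu> * complex_of_real (mpower x \<mu>))"
  using assms unfolding polys_def by blast

lemma polys_mono:
  assumes "p \<in> polys N" "N \<le> N'"
  shows "p \<in> polys N'"
  using assms by (elim polysE) (auto intro!: polys_sum polys_monomial)

lemma polys_exppoly: "p \<in> polys N \<Longrightarrow> p \<in> exppoly X"
  by (elim polysE) (auto intro!: exppoly_sum exppoly_cmult exppoly_mpower)

lemma mpower_add: "mpower x (\<mu> + \<kappa>) = mpower x \<mu> * mpower x \<kappa>"
  by (simp add: mpower_def power_add prod.distrib)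

lemma mabs_add: "mabs (\<mu> + \<kappa>) = mabs \<mu> + mabs \<kappa>"
  by (simp add: mabs_def sum.distrib)

lemma polys_mult:
  assumes "p \<in> polys N" "q \<in> polys N'"
  shows "(\<lambda>x. p x * q x) \<in> polys (N + N')"
proof -
  obtain c d where "p = (\<lambda>x. \<Sum>\<mu> | mabs \<mu> \<le> N. c \<mu> * complex_of_real (mpower x \<mu>))"
    "q = (\<lambda>x. \<Sum>\<mu> | mabs \<mu> \<le> N'. d \<mu> * complex_of_real (mpower x \<mu>))"
    using assms unfolding polys_def by blast
  then have "(\<lambda>x. p x * q x) = (\<lambda>x. \<Sum>\<mu> | mabs \<mu> \<le> N. \<Sum>\<kappa> | mabs \<kappa> \<le> N'.
      (c \<mu> * d \<kappa>) * complex_of_real (mpower x (\<mu> + \<kappa>)))"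
    by (simp add: sum_product mpower_add mult_ac)
  also have "\<dots> \<in> polys (N + N')"
    by (intro polys_sum polys_monomial) (auto simp: mabs_add)
  finally show ?thesis .
qed

lemma polys_scale:
  assumes "p \<in> polys N"
  shows "(\<lambda>x. p (c *\<^sub>R x)) \<in> polys N"
proof -
  obtain d where "p = (\<lambda>x. \<Sum>\<mu> | mabs \<mu> \<le> N. d \<mu> * complex_of_real (mpower x \<mu>))"
    using assms by (elim polysE)
  then have "(\<lambda>x. p (c *\<^sub>R x)) = (\<lambda>x. \<Sum>\<mu> | mabs \<mu> \<le> N.
      (d \<mu> * of_real c ^ mabs \<mu>) * complex_of_real (mpower x \<mu>))"
    by (simp add: mpower_scaleR mult_ac)
  also have "\<dots> \<in> polys N"
    by (intro polys_sum polys_monomial) auto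
  finally show ?thesis .
qed

text \<open>Without frequencies only polynomials remain. This yields polynomiality of derivatives
  and of affine substitutions with no degree bookkeeping.\<close>

lemma exppoly_empty_polys: "p \<in> exppoly {} \<Longrightarrow> \<exists>N. p \<in> polys N"
proof (induction rule: exppoly.induct)
  case (const c)
  then show ?case using polys_monomial[of 0 0 c] by auto
next
  case (coord i)
  show ?case
    using polys_monomial[of "0 + axis i 1" 1 1] unfolding mpower_add_axis mabs_add_axis
    by (auto simp: One_nat_def)
next
  case (add f g)
  then obtain N N' where "f \<in> polys N" "g \<in> polys N'" by blast
  then have "(\<lambda>x. f x + g x) \<in> polys (max N N')"
    by (intro polys_add) (auto intro: polys_mono)
  then show ?case by blast
next
  case (mult f g)
  then show ?case using polys_mult by blast
qed simp

section \<open>One subdivision step on Hermite data\<close>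

lemma hermite_data_nth [simp]: "hermite_data \<nu> \<tau> p k $ i $ l = mdiff (\<nu> l) p (emb k + \<tau> l)"
  by (simp add: hermite_data_def)

lemma finite_mask_support:
  assumes "finitely_supported a" "c \<noteq> (0 :: int)"
  shows "finite {k. a (j - c *s k) \<noteq> 0}"
proof -
  have "inj (\<lambda>k. j - c *s k)"
    using assms(2) by (auto simp: inj_on_def vec_eq_iff)
  from finite_vimageI[OF assms(1)[unfolded finitely_supported_def] this] show ?thesis
    by (simp add: vimage_def)
qed

lemma subdiv_nth:
  fixes a :: "('d::finite, 'r::finite, 'r) mseq"
  shows "subdiv a v j $ i $ l' =
    2 ^ CARD('d) * (\<Sum>k | a (j - 2 *s k) \<noteq> 0. \<Sum>l\<in>UNIV. v k $ i $ l * a (j - 2 *s k) $ l $ l')"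
  by (simp add: subdiv_def matrix_matrix_mult_def) (simp add: scaleR_conv_of_real)

lemma hexp_shift: "hexp \<alpha> (y + z) \<xi> = hexp \<alpha> y \<xi> * exp (\<i> * complex_of_real (z \<bullet> \<xi>))"
  by (simp add: hexp_def inner_add_left distrib_left exp_add)

text \<open>The part of the symbol of \<open>a\<close> that lives on the coset j + 2Z^d. It is
  summed over \<open>k\<close> rather than over the coset points to match the sum in
  \<open>subdiv\<close>.\<close>

definition coset_symbol ::
    "('d::finite, 'r::finite, 'r) mseq \<Rightarrow> 'd ivec \<Rightarrow> 'r \<Rightarrow> 'r \<Rightarrow> 'd rvec \<Rightarrow> complex" where
  "coset_symbol a j l l' \<xi> = (\<Sum>k | a (j - 2 *s k) \<noteq> 0.
     a (j - 2 *s k) $ l $ l' * exp (- (\<i> * complex_of_real (emb (j - 2 *s k) \<bullet> \<xi>))))"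

lemma exppoly_exp_uminus: "(\<lambda>\<xi>. exp (- (\<i> * complex_of_real (y \<bullet> \<xi>)))) \<in> exppoly UNIV"
  using exppoly.exp[of "-y" UNIV] by simp

lemma exppoly_coset_symbol: "coset_symbol a j l l' \<in> exppoly UNIV"
  unfolding coset_symbol_def[abs_def] by (intro exppoly_sum exppoly_cmult exppoly_exp_uminus)

lemma exppoly_scale: "f \<in> exppoly UNIV \<Longrightarrow> (\<lambda>\<xi>. f (c *\<^sub>R \<xi>)) \<in> exppoly UNIV"
  using exppoly_affine[of f UNIV c 0] by simp

lemma emb_diff: "emb (j - k) = emb j - emb k"
  by (simp add: emb_def vec_eq_iff)

lemma emb_scale: "emb (c *s k) = of_int c *\<^sub>R emb k"
  by (simp add: emb_def vec_eq_iff)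

lemma mdiff_monomial_scale:
  "mdiff \<alpha> (\<lambda>x. complex_of_real (mpower (c *\<^sub>R x) \<mu>)) y =
    of_real c ^ mabs \<mu> * mdiff \<alpha> (\<lambda>x. complex_of_real (mpower x \<mu>)) y"
proof -
  have "mdiff \<alpha> (\<lambda>x. complex_of_real (mpower (c *\<^sub>R x) \<mu>)) y =
      mdiff \<alpha> (\<lambda>x. of_real c ^ mabs \<mu> * complex_of_real (mpower x \<mu>)) y"
    by (simp add: mpower_scaleR)
  then show ?thesis
    by (simp add: mdiff_cmult[OF exppoly_mpower])
qed

lemma mdiff_polys:
  assumes "p = (\<lambda>x. \<Sum>\<mu> | mabs \<mu> \<le> M. c \<mu> * complex_of_real (mpower x \<mu>))"
  shows "mdiff \<alpha> p y =
    (\<Sum>\<mu> | mabs \<mu> \<le> M. c \<mu> * mdiff \<alpha> (\<lambda>x. complex_of_real (mpower x \<mu>)) y)"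
  unfolding assms
  by (subst mdiff_sum[of _ _ UNIV]) (auto simp: mdiff_cmult[OF exppoly_mpower] intro!: exppoly_cmult exppoly_mpower)

text \<open>Both sides are linear in \<open>p\<close> and the monomials span \<open>polys M\<close>.
  The factor \<open>(1/2) ^ mabs \<mu>\<close> is the homogeneity of a monomial under
  p(x/2).\<close>

lemma subdiv_hermite_data_iff_monomials:
  fixes a :: "('d::{finite,linorder}, 'r::finite, 'r) mseq" and \<nu> \<tau>
  defines "L \<equiv> \<lambda>p j l'. 2 ^ CARD('d) * (\<Sum>k | a (j - 2 *s k) \<noteq> 0.
     \<Sum>l\<in>UNIV. mdiff (\<nu> l) p (emb k + \<tau> l) * a (j - 2 *s k) $ l $ l')"
  shows "(\<forall>p\<in>polys M. subdiv a (hermite_data \<nu> \<tau> p) = hermite_data \<nu> \<tau> (\<lambda>x. p ((1/2) *\<^sub>R x))) \<longleftrightarrow>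
    (\<forall>j l' \<mu>. mabs \<mu> \<le> M \<longrightarrow> L (\<lambda>x. complex_of_real (mpower x \<mu>)) j l' =
      (1/2) ^ mabs \<mu> * mdiff (\<nu> l') (\<lambda>x. complex_of_real (mpower x \<mu>)) (emb j + \<tau> l'))"
    (is "_ \<longleftrightarrow> ?R")
proof
  assume *: "\<forall>p\<in>polys M. subdiv a (hermite_data \<nu> \<tau> p) = hermite_data \<nu> \<tau> (\<lambda>x. p ((1/2) *\<^sub>R x))"
  show ?R
  proof (intro allI impI)
    fix j l' \<mu> assume "mabs (\<mu> :: 'd multiindex) \<le> M"
    then have "(\<lambda>x. complex_of_real (mpower x \<mu>)) \<in> polys M"
      using polys_monomial[of \<mu> M 1] by simp
    then have "subdiv a (hermite_data \<nu> \<tau> (\<lambda>x. complex_of_real (mpower x \<mu>))) =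
        hermite_data \<nu> \<tau> (\<lambda>x. complex_of_real (mpower ((1/2) *\<^sub>R x) \<mu>))"
      using * by blast
    then have "subdiv a (hermite_data \<nu> \<tau> (\<lambda>x. complex_of_real (mpower x \<mu>))) j $ (1::1) $ l' =
        hermite_data \<nu> \<tau> (\<lambda>x. complex_of_real (mpower ((1/2) *\<^sub>R x) \<mu>)) j $ 1 $ l'"
      by simp
    then show "L (\<lambda>x. complex_of_real (mpower x \<mu>)) j l' =
      (1/2) ^ mabs \<mu> * mdiff (\<nu> l') (\<lambda>x. complex_of_real (mpower x \<mu>)) (emb j + \<tau> l')"
      unfolding subdiv_nth hermite_data_nth L_def mdiff_monomial_scale by simp
  qed
next
  assume R: ?R
  show "\<forall>p\<in>polys M. subdiv a (hermite_data \<nu> \<tau> p) = hermite_data \<nu> \<tau> (\<lambda>x. p ((1/2) *\<^sub>R x))"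
  proof
    fix p :: "'d rvec \<Rightarrow> complex" assume "p \<in> polys M"
    then obtain c where c: "p = (\<lambda>x. \<Sum>\<mu> | mabs \<mu> \<le> M. c \<mu> * complex_of_real (mpower x \<mu>))"
      by (elim polysE)
    have "(\<lambda>x. p ((1/2) *\<^sub>R x)) =
        (\<lambda>x. \<Sum>\<mu> | mabs \<mu> \<le> M. (c \<mu> * (1/2) ^ mabs \<mu>) * complex_of_real (mpower x \<mu>))"
      unfolding c mpower_scaleR by (simp add: mult_ac)
    note c' = mdiff_polys[OF this]
    have "L p j l' = (\<Sum>\<mu> | mabs \<mu> \<le> M. c \<mu> * L (\<lambda>x. complex_of_real (mpower x \<mu>)) j l')" for j l'
    proof -
      have "L p j l' = (\<Sum>k | a (j - 2 *s k) \<noteq> 0. \<Sum>l\<in>UNIV. \<Sum>\<mu> | mabs \<mu> \<le> M.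
        c \<mu> * (2 ^ CARD('d) * (mdiff (\<nu> l) (\<lambda>x. complex_of_real (mpower x \<mu>)) (emb k + \<tau> l)
          * a (j - 2 *s k) $ l $ l')))"
        unfolding L_def mdiff_polys[OF c] sum_distrib_left sum_distrib_right by (simp add: mult_ac)
      also have "\<dots> = (\<Sum>k | a (j - 2 *s k) \<noteq> 0. \<Sum>\<mu> | mabs \<mu> \<le> M. \<Sum>l\<in>UNIV.
        c \<mu> * (2 ^ CARD('d) * (mdiff (\<nu> l) (\<lambda>x. complex_of_real (mpower x \<mu>)) (emb k + \<tau> l)
          * a (j - 2 *s k) $ l $ l')))"
        by (subst sum.swap) (rule refl)
      also have "\<dots> = (\<Sum>\<mu> | mabs \<mu> \<le> M. \<Sum>k | a (j - 2 *s k) \<noteq> 0. \<Sum>l\<in>UNIV.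
        c \<mu> * (2 ^ CARD('d) * (mdiff (\<nu> l) (\<lambda>x. complex_of_real (mpower x \<mu>)) (emb k + \<tau> l)
          * a (j - 2 *s k) $ l $ l')))"
        by (rule sum.swap)
      also have "\<dots> = (\<Sum>\<mu> | mabs \<mu> \<le> M. c \<mu> * L (\<lambda>x. complex_of_real (mpower x \<mu>)) j l')"
        unfolding L_def by (simp only: sum_distrib_left)
      finally show ?thesis .
    qed
    also have "\<dots> j l' = mdiff (\<nu> l') (\<lambda>x. p ((1/2) *\<^sub>R x)) (emb j + \<tau> l')" for j l'
      unfolding c' using R by (intro sum.cong) (auto simp: mult.assoc)
    finally show "subdiv a (hermite_data \<nu> \<tau> p) = hermite_data \<nu> \<tau> (\<lambda>x. p ((1/2) *\<^sub>R x))"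
      by (simp add: fun_eq_iff vec_eq_iff subdiv_nth L_def)
  qed
qed

text \<open>The equation for the monomial of exponent \<mu> is the equality of the \<mu>th
  derivatives at 0 of two functions of \<xi>, so all monomials of degree at most \<open>M\<close>
  together give agreement of order \<open>M + 1\<close>.\<close>

lemma subdiv_hermite_data_iff:
  fixes a :: "('d::{finite,linorder}, 'r::finite, 'r) mseq"
  shows "(\<forall>p\<in>polys M. subdiv a (hermite_data \<nu> \<tau> p) = hermite_data \<nu> \<tau> (\<lambda>x. p ((1/2) *\<^sub>R x))) \<longleftrightarrow>
    (\<forall>j l'. eq_upto_O (M + 1)
      (\<lambda>\<xi>. 2 ^ CARD('d) * (\<Sum>l\<in>UNIV. hexp (\<nu> l) (\<tau> l) (2 *\<^sub>R \<xi>) * coset_symbol a j l l' \<xi>))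
      (hexp (\<nu> l') (\<tau> l')))"
  unfolding subdiv_hermite_data_iff_monomials
proof (intro all_cong1)
  fix j l'
  \<comment> \<open>Generating function of the left-hand sides: by \<open>mdiff_hexp\<close> its
    \<mu>th derivative at 0 is \<open>\<i> ^ mabs \<mu>\<close> times the left-hand side for the
    monomial of exponent \<mu>.\<close>
  define G where "G \<xi> = 2 ^ CARD('d) * (\<Sum>k | a (j - 2 *s k) \<noteq> 0.
     \<Sum>l\<in>UNIV. a (j - 2 *s k) $ l $ l' * hexp (\<nu> l) (emb k + \<tau> l) \<xi>)" for \<xi>
  have G: "G \<in> exppoly UNIV"
    unfolding G_def[abs_def] by (intro exppoly_cmult exppoly_sum exppoly_hexp)
  have "mdiff \<mu> G 0 = \<i> ^ mabs \<mu> * (2 ^ CARD('d) * (\<Sum>k | a (j - 2 *s k) \<noteq> 0.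
     \<Sum>l\<in>UNIV. mdiff (\<nu> l) (\<lambda>x. complex_of_real (mpower x \<mu>)) (emb k + \<tau> l) * a (j - 2 *s k) $ l $ l'))"
    for \<mu>
    unfolding G_def[abs_def]
    by (simp only: mdiff_cmult[OF exppoly_sum[OF exppoly_sum[OF exppoly_cmult[OF exppoly_hexp]]]]
      mdiff_sum[OF exppoly_sum[OF exppoly_cmult[OF exppoly_hexp]]]
      mdiff_sum[OF exppoly_cmult[OF exppoly_hexp]] mdiff_cmult[OF exppoly_hexp] mdiff_hexp)
      (simp add: sum_distrib_left mult_ac)
  \<comment> \<open>Moving \<open>(1/2) ^ mabs \<mu>\<close> to the other side gives the factor that
    the dilation of \<xi> by 2 produces in the \<mu>th derivative.\<close>
  then have "2 ^ CARD('d) * (\<Sum>k | a (j - 2 *s k) \<noteq> 0.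
     \<Sum>l\<in>UNIV. mdiff (\<nu> l) (\<lambda>x. complex_of_real (mpower x \<mu>)) (emb k + \<tau> l) * a (j - 2 *s k) $ l $ l')
      = (1/2) ^ mabs \<mu> * mdiff (\<nu> l') (\<lambda>x. complex_of_real (mpower x \<mu>)) (emb j + \<tau> l') \<longleftrightarrow>
     mdiff \<mu> (\<lambda>\<xi>. G (2 *\<^sub>R \<xi>)) 0 = mdiff \<mu> (hexp (\<nu> l') (emb j + \<tau> l')) 0" for \<mu>
    unfolding mdiff_hexp mdiff_scale[OF G UNIV_I] by (simp add: field_simps power_one_over)
  then have "(\<forall>\<mu>. mabs \<mu> \<le> M \<longrightarrow> 2 ^ CARD('d) * (\<Sum>k | a (j - 2 *s k) \<noteq> 0.
     \<Sum>l\<in>UNIV. mdiff (\<nu> l) (\<lambda>x. complex_of_real (mpower x \<mu>)) (emb k + \<tau> l) * a (j - 2 *s k) $ l $ l')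
      = (1/2) ^ mabs \<mu> * mdiff (\<nu> l') (\<lambda>x. complex_of_real (mpower x \<mu>)) (emb j + \<tau> l')) \<longleftrightarrow>
     eq_upto_O (M + 1) (\<lambda>\<xi>. G (2 *\<^sub>R \<xi>)) (hexp (\<nu> l') (emb j + \<tau> l'))"
    unfolding eq_upto_O_def by (simp add: less_Suc_eq_le flip: Suc_eq_plus1)
  \<comment> \<open>Modulation by frequency \<open>- emb j\<close> removes \<open>j\<close> from the
    target; on the left the phase of frequency \<open>2 k - j\<close> is precisely the one in
    \<open>coset_symbol\<close>.\<close>
  also have "\<dots> \<longleftrightarrow> eq_upto_O (M + 1)
     (\<lambda>\<xi>. G (2 *\<^sub>R \<xi>) * exp (\<i> * complex_of_real ((- emb j) \<bullet> \<xi>)))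
     (\<lambda>\<xi>. hexp (\<nu> l') (emb j + \<tau> l') \<xi> * exp (\<i> * complex_of_real ((- emb j) \<bullet> \<xi>)))"
    by (rule eq_upto_O_mult_exp_iff[symmetric]) (intro exppoly_scale G exppoly_hexp)+
  also have "(\<lambda>\<xi>. hexp (\<nu> l') (emb j + \<tau> l') \<xi> * exp (\<i> * complex_of_real ((- emb j) \<bullet> \<xi>)))
      = hexp (\<nu> l') (\<tau> l')"
    unfolding hexp_shift[symmetric] by simp
  also have "(\<lambda>\<xi>. G (2 *\<^sub>R \<xi>) * exp (\<i> * complex_of_real ((- emb j) \<bullet> \<xi>))) =
      (\<lambda>\<xi>. 2 ^ CARD('d) * (\<Sum>l\<in>UNIV. hexp (\<nu> l) (\<tau> l) (2 *\<^sub>R \<xi>) * coset_symbol a j l l' \<xi>))"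
  proof
    fix \<xi>
    have "hexp (\<nu> l) (emb k + \<tau> l) (2 *\<^sub>R \<xi>) * exp (\<i> * complex_of_real ((- emb j) \<bullet> \<xi>)) =
        hexp (\<nu> l) (\<tau> l) (2 *\<^sub>R \<xi>) * exp (- (\<i> * complex_of_real (emb (j - 2 *s k) \<bullet> \<xi>)))" for k l
      unfolding add.commute[of "emb k"] hexp_shift
      by (simp add: emb_diff emb_scale inner_diff_left algebra_simps flip: exp_add)
    then have "G (2 *\<^sub>R \<xi>) * exp (\<i> * complex_of_real ((- emb j) \<bullet> \<xi>)) =
        2 ^ CARD('d) * (\<Sum>k | a (j - 2 *s k) \<noteq> 0. \<Sum>l\<in>UNIV. hexp (\<nu> l) (\<tau> l) (2 *\<^sub>R \<xi>) *
          (a (j - 2 *s k) $ l $ l' * exp (- (\<i> * complex_of_real (emb (j - 2 *s k) \<bullet> \<xi>)))))"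
      unfolding G_def by (simp add: sum_distrib_left sum_distrib_right mult.assoc mult.left_commute)
    then show "G (2 *\<^sub>R \<xi>) * exp (\<i> * complex_of_real ((- emb j) \<bullet> \<xi>)) =
      2 ^ CARD('d) * (\<Sum>l\<in>UNIV. hexp (\<nu> l) (\<tau> l) (2 *\<^sub>R \<xi>) * coset_symbol a j l l' \<xi>)"
      unfolding coset_symbol_def sum_distrib_left[of "hexp _ _ _"]
      by (subst (asm) sum.swap) simp
  qed
  finally show "(\<forall>\<mu>. mabs \<mu> \<le> M \<longrightarrow> 2 ^ CARD('d) * (\<Sum>k | a (j - 2 *s k) \<noteq> 0.
     \<Sum>l\<in>UNIV. mdiff (\<nu> l) (\<lambda>x. complex_of_real (mpower x \<mu>)) (emb k + \<tau> l) * a (j - 2 *s k) $ l $ l')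
      = (1/2) ^ mabs \<mu> * mdiff (\<nu> l') (\<lambda>x. complex_of_real (mpower x \<mu>)) (emb j + \<tau> l')) \<longleftrightarrow>
     eq_upto_O (M + 1)
      (\<lambda>\<xi>. 2 ^ CARD('d) * (\<Sum>l\<in>UNIV. hexp (\<nu> l) (\<tau> l) (2 *\<^sub>R \<xi>) * coset_symbol a j l l' \<xi>))
      (hexp (\<nu> l') (\<tau> l'))" .
qed

section \<open>Sum rules as relations between coset symbols\<close>

lemma fourier_nth:
  assumes "finite S" "\<And>k. k \<notin> S \<Longrightarrow> u k = 0"
  shows "fourier u \<xi> $ i $ j = (\<Sum>k\<in>S. u k $ i $ j * exp (- (\<i> * complex_of_real (emb k \<bullet> \<xi>))))"
proof -
  have "(\<Sum>k | u k \<noteq> 0. u k $ i $ j * exp (- (\<i> * complex_of_real (emb k \<bullet> \<xi>)))) =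
      (\<Sum>k\<in>S. u k $ i $ j * exp (- (\<i> * complex_of_real (emb k \<bullet> \<xi>))))"
    using assms by (intro sum.mono_neutral_left) auto
  then show ?thesis by (simp add: fourier_def)
qed

lemma exppoly_fourier: "(\<lambda>\<xi>. fourier u \<xi> $ i $ j) \<in> exppoly UNIV"
  by (simp add: fourier_def exppoly_sum exppoly_cmult exppoly_exp_uminus)

lemma exppoly_fourier_shift: "(\<lambda>\<xi>. fourier u (\<xi> + b) $ i $ j) \<in> exppoly UNIV"
  using exppoly_affine[OF exppoly_fourier[of u i j] UNIV_I, of 1 b] by simp

lemma exp_int_pi:
  "exp (- (\<i> * complex_of_real (pi * real_of_int k))) = (if even k then 1 else -1)"
proof (cases "even k")
  case True
  then obtain n where "k = 2 * n" by blast
  then show ?thesis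
    using exp_integer_2pi[of "of_int (-n)"] by (simp add: mult_ac)
next
  case False
  then obtain n where k: "k = 2 * n + 1" by (elim oddE)
  have "exp (- (\<i> * complex_of_real (pi * real_of_int k))) =
      exp (2 * of_int (-n) * of_real pi * \<i>) * exp (- (of_real pi * \<i>))"
    unfolding k exp_add[symmetric] by (rule arg_cong[of _ _ exp]) (simp add: algebra_simps)
  then show ?thesis
    using False exp_integer_2pi[of "of_int (-n)"] by (simp add: exp_minus)
qed

section \<open>Fourier inversion on the cosets of 2Z^d\<close>

abbreviation cube_vertices :: "'d::finite ivec set" where
  "cube_vertices \<equiv> {\<omega>. \<forall>i. \<omega> $ i \<in> {0, 1}}"

text \<open>This is the sign (-1)^(k.\<omega>), a character of Z^d/2Z^d in either argument, kept in
  the exponential form in which it arises from a symbol at \<xi> + \<pi>\<omega>.\<close>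

definition pi_character :: "'d::finite ivec \<Rightarrow> 'd ivec \<Rightarrow> complex" where
  "pi_character k \<omega> = exp (- (\<i> * complex_of_real (emb k \<bullet> (pi *\<^sub>R emb \<omega>))))"

lemma emb_0 [simp]: "emb 0 = 0"
  by (simp add: emb_def vec_eq_iff)

lemma pi_character_0 [simp]: "pi_character k 0 = 1" "pi_character 0 k = 1"
  by (simp_all add: pi_character_def)

lemma pi_character_commute: "pi_character k \<omega> = pi_character \<omega> k"
  by (simp add: pi_character_def inner_commute)

lemma pi_character_add: "pi_character (k + h) \<omega> = pi_character k \<omega> * pi_character h \<omega>"
proof -
  have "emb (k + h) = emb k + emb h" by (simp add: emb_def vec_eq_iff)
  then show ?thesis
    by (simp add: pi_character_def inner_add_left algebra_simps flip: exp_add)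
qed

lemma pi_character_uminus: "pi_character (- k) \<omega> = pi_character (- \<omega>) k"
  by (simp add: pi_character_def inner_vec_def emb_def mult_ac)

text \<open>Orthogonality of characters: the sum factors over the coordinates, and an odd coordinate
  contributes 1 - 1 = 0.\<close>

lemma sum_pi_character:
  "(\<Sum>\<omega>\<in>cube_vertices. pi_character k \<omega>) = (if \<forall>i. even (k $ i) then 2 ^ CARD('d) else 0)"
  for k :: "'d::finite ivec"
proof -
  have "pi_character k \<omega> = (\<Prod>i\<in>UNIV. exp (- (\<i> * complex_of_real (pi * real_of_int (k $ i * \<omega> $ i)))))"
    for \<omega>
    unfolding pi_character_def inner_vec_def
    by (simp add: emb_def sum_distrib_left exp_sum mult_ac flip: sum_negf)
  then have "(\<Sum>\<omega>\<in>cube_vertices. pi_character k \<omega>) =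
      (\<Prod>i\<in>UNIV. \<Sum>s\<in>{0, 1}. exp (- (\<i> * complex_of_real (pi * real_of_int (k $ i * s)))))"
    by (simp only: sum_prod_vec[of "{0, 1}", symmetric] finite.intros)
  also have "\<dots> = (\<Prod>i\<in>UNIV. if even (k $ i) then 2 else 0)"
    unfolding exp_int_pi by (intro prod.cong) auto
  also have "\<dots> = (if \<forall>i. even (k $ i) then 2 ^ CARD('d) else 0)"
    by (auto intro: prod_zero)
  finally show ?thesis .
qed

lemma fourier_pi_shift:
  "fourier a (\<xi> + pi *\<^sub>R emb \<omega>) $ l $ l' = (\<Sum>k | a k \<noteq> 0.
    a k $ l $ l' * exp (- (\<i> * complex_of_real (emb k \<bullet> \<xi>))) * pi_character k \<omega>)"
  by (simp add: fourier_def pi_character_def inner_add_right algebra_simps flip: exp_add)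

text \<open>Averaging the shifted symbols against a character projects onto a coset: the term at
  \<open>k\<close> survives exactly when \<open>k - j\<close> is even in every coordinate.\<close>

lemma coset_symbol_fourier:
  fixes a :: "('d::finite, 'r::finite, 'r) mseq"
  assumes "finitely_supported a"
  shows "2 ^ CARD('d) * coset_symbol a j l l' \<xi> =
    (\<Sum>\<omega>\<in>cube_vertices. pi_character (- j) \<omega> * fourier a (\<xi> + pi *\<^sub>R emb \<omega>) $ l $ l')"
proof -
  let ?e = "\<lambda>k. a k $ l $ l' * exp (- (\<i> * complex_of_real (emb k \<bullet> \<xi>)))"
  have *: "k \<in> (\<lambda>h. j - 2 *s h) ` {h. a (j - 2 *s h) \<noteq> 0} \<longleftrightarrow> a k \<noteq> 0 \<and> (\<forall>i. even ((k - j) $ i))" for k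
  proof
    assume R: "a k \<noteq> 0 \<and> (\<forall>i. even ((k - j) $ i))"
    then have "k = j - 2 *s (\<chi> i. (j $ i - k $ i) div 2)"
      by (auto simp: vec_eq_iff)
    with R show "k \<in> (\<lambda>h. j - 2 *s h) ` {h. a (j - 2 *s h) \<noteq> 0}"
      by (intro image_eqI[of _ _ "\<chi> i. (j $ i - k $ i) div 2"]) auto
  qed auto
  have "coset_symbol a j l l' \<xi> = (\<Sum>k\<in>(\<lambda>h. j - 2 *s h) ` {h. a (j - 2 *s h) \<noteq> 0}. ?e k)"
    unfolding coset_symbol_def by (subst sum.reindex) (auto simp: inj_on_def vec_eq_iff)
  also have "(\<lambda>h. j - 2 *s h) ` {h. a (j - 2 *s h) \<noteq> 0} = {k \<in> {k. a k \<noteq> 0}. \<forall>i. even ((k - j) $ i)}"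
    using * by blast
  also have "(\<Sum>k\<in>\<dots>. ?e k) = (\<Sum>k | a k \<noteq> 0. if \<forall>i. even ((k - j) $ i) then ?e k else 0)"
    using assms unfolding finitely_supported_def by (rule sum.inter_filter)
  finally have cs: "coset_symbol a j l l' \<xi> =
      (\<Sum>k | a k \<noteq> 0. if \<forall>i. even ((k - j) $ i) then ?e k else 0)" .
  have "2 ^ CARD('d) * coset_symbol a j l l' \<xi> =
      (\<Sum>k | a k \<noteq> 0. ?e k * (if \<forall>i. even ((k - j) $ i) then 2 ^ CARD('d) else 0))"
    unfolding cs sum_distrib_left by (intro sum.cong) auto
  also have "\<dots> = (\<Sum>k | a k \<noteq> 0. \<Sum>\<omega>\<in>cube_vertices. pi_character (- j) \<omega> * (?e k * pi_character k \<omega>))"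
    unfolding sum_pi_character[symmetric] sum_distrib_left
    using pi_character_add[of _ "- j"] by (simp add: mult_ac)
  also have "\<dots> = (\<Sum>\<omega>\<in>cube_vertices. \<Sum>k | a k \<noteq> 0. pi_character (- j) \<omega> * (?e k * pi_character k \<omega>))"
    by (rule sum.swap)
  also have "\<dots> = (\<Sum>\<omega>\<in>cube_vertices. pi_character (- j) \<omega> * fourier a (\<xi> + pi *\<^sub>R emb \<omega>) $ l $ l')"
    unfolding fourier_pi_shift sum_distrib_left ..
  finally show ?thesis .
qed

lemma finite_cube_vertices: "finite (cube_vertices :: 'd::finite ivec set)"
  by (rule finite_vec_set) simp

text \<open>The inverse transform, obtained from orthogonality in the dual variable; the cube
  vertices represent every class modulo 2 exactly once.\<close>

lemma fourier_coset_symbol: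
  fixes a :: "('d::finite, 'r::finite, 'r) mseq"
  assumes "finitely_supported a" and \<omega>: "\<omega> \<in> cube_vertices"
  shows "fourier a (\<xi> + pi *\<^sub>R emb \<omega>) $ l $ l' =
    (\<Sum>\<gamma>\<in>cube_vertices. pi_character \<gamma> \<omega> * coset_symbol a \<gamma> l l' \<xi>)"
proof -
  let ?F = "\<lambda>\<omega>. fourier a (\<xi> + pi *\<^sub>R emb \<omega>) $ l $ l'"
  have "2 ^ CARD('d) * (\<Sum>\<gamma>\<in>cube_vertices. pi_character \<gamma> \<omega> * coset_symbol a \<gamma> l l' \<xi>) =
      (\<Sum>\<gamma>\<in>cube_vertices. pi_character \<gamma> \<omega> * (2 ^ CARD('d) * coset_symbol a \<gamma> l l' \<xi>))"
    by (simp add: sum_distrib_left mult_ac)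
  also have "\<dots> = (\<Sum>\<gamma>\<in>cube_vertices. \<Sum>\<omega>'\<in>cube_vertices. ?F \<omega>' * pi_character (\<omega> + - \<omega>') \<gamma>)"
  proof -
    have "pi_character (\<omega> + - \<omega>') \<gamma> = pi_character \<gamma> \<omega> * pi_character (- \<gamma>) \<omega>'" for \<gamma> \<omega>'
      by (metis pi_character_add pi_character_commute pi_character_uminus)
    then show ?thesis
      unfolding coset_symbol_fourier[OF assms(1)] sum_distrib_left by (simp add: mult_ac)
  qed
  also have "\<dots> = (\<Sum>\<omega>'\<in>cube_vertices. ?F \<omega>' * (\<Sum>\<gamma>\<in>cube_vertices. pi_character (\<omega> + - \<omega>') \<gamma>))"
    unfolding sum_distrib_left by (rule sum.swap)
  also have "\<dots> = (\<Sum>\<omega>'\<in>cube_vertices. if \<omega>' = \<omega> then ?F \<omega> * 2 ^ CARD('d) else 0)"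
  proof (rule sum.cong[OF refl])
    fix \<omega>' :: "'d ivec" assume \<omega>': "\<omega>' \<in> cube_vertices"
    \<comment> \<open>Two entries from {0,1} with even difference coincide.\<close>
    have "(\<forall>i. even ((\<omega> + - \<omega>') $ i)) \<longleftrightarrow> \<omega>' = \<omega>"
    proof
      assume *: "\<forall>i. even ((\<omega> + - \<omega>') $ i)"
      have "\<omega>' $ i = \<omega> $ i" for i
        using \<omega> \<omega>' *[THEN spec, of i] by (auto dest!: spec[of _ i])
      then show "\<omega>' = \<omega>" by (simp add: vec_eq_iff)
    qed simp
    then show "?F \<omega>' * (\<Sum>\<gamma>\<in>cube_vertices. pi_character (\<omega> + - \<omega>') \<gamma>) =
        (if \<omega>' = \<omega> then ?F \<omega> * 2 ^ CARD('d) else 0)"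
      unfolding sum_pi_character by auto
  qed
  also have "\<dots> = ?F \<omega> * 2 ^ CARD('d)"
    using \<omega> by (subst sum.delta[OF finite_cube_vertices]) simp
  finally show ?thesis by simp
qed

text \<open>The transform pair acts on the mask only and has constant coefficients, so it preserves
  agreement of jets. The same right-hand side \<open>v\<close> on every coset corresponds to
  \<open>v\<close> at \<omega> = 0 and zero elsewhere, as the transform of a constant is
  concentrated at the trivial character.\<close>

lemma coset_relation_iff:
  fixes a :: "('d::{finite,linorder}, 'r::finite, 'r) mseq"
    and h :: "'r \<Rightarrow> 'd rvec \<Rightarrow> complex"
  assumes "finitely_supported a" and h: "\<And>l. h l \<in> exppoly UNIV" and v: "v \<in> exppoly UNIV"
  shows "(\<forall>j. eq_upto_O N (\<lambda>\<xi>. 2 ^ CARD('d) * (\<Sum>l\<in>UNIV. h l \<xi> * coset_symbol a j l l' \<xi>)) v) \<longleftrightarrow>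
    (\<forall>\<omega>\<in>cube_vertices. eq_upto_O N (\<lambda>\<xi>. \<Sum>l\<in>UNIV. h l \<xi> * fourier a (\<xi> + pi *\<^sub>R emb \<omega>) $ l $ l')
       (\<lambda>\<xi>. if \<omega> = 0 then v \<xi> else 0))"
    (is "(\<forall>j. eq_upto_O N (?C j) v) \<longleftrightarrow> (\<forall>\<omega>\<in>_. eq_upto_O N (?F \<omega>) (?v \<omega>))")
proof -
  have C: "?C j = (\<lambda>\<xi>. \<Sum>\<omega>\<in>cube_vertices. pi_character (- j) \<omega> * ?F \<omega> \<xi>)" for j
  proof
    fix \<xi>
    have "?C j \<xi> = (\<Sum>l\<in>UNIV. h l \<xi> * (2 ^ CARD('d) * coset_symbol a j l l' \<xi>))"
      by (simp add: sum_distrib_left mult_ac)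
    also have "\<dots> = (\<Sum>l\<in>UNIV. \<Sum>\<omega>\<in>cube_vertices.
        pi_character (- j) \<omega> * (h l \<xi> * fourier a (\<xi> + pi *\<^sub>R emb \<omega>) $ l $ l'))"
      unfolding coset_symbol_fourier[OF assms(1)] by (simp add: sum_distrib_left mult_ac)
    also have "\<dots> = (\<Sum>\<omega>\<in>cube_vertices. pi_character (- j) \<omega> * ?F \<omega> \<xi>)"
      unfolding sum_distrib_left by (rule sum.swap)
    finally show "?C j \<xi> = (\<Sum>\<omega>\<in>cube_vertices. pi_character (- j) \<omega> * ?F \<omega> \<xi>)" .
  qed
  have F: "?F \<omega> = (\<lambda>\<xi>. \<Sum>\<gamma>\<in>cube_vertices. (pi_character \<gamma> \<omega> / 2 ^ CARD('d)) * ?C \<gamma> \<xi>)"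
    if "\<omega> \<in> cube_vertices" for \<omega>
  proof
    fix \<xi>
    have "?F \<omega> \<xi> = (\<Sum>l\<in>UNIV. \<Sum>\<gamma>\<in>cube_vertices.
        pi_character \<gamma> \<omega> * (h l \<xi> * coset_symbol a \<gamma> l l' \<xi>))"
      unfolding fourier_coset_symbol[OF assms(1) that] by (simp add: sum_distrib_left mult_ac)
    also have "\<dots> = (\<Sum>\<gamma>\<in>cube_vertices. pi_character \<gamma> \<omega> * (\<Sum>l\<in>UNIV. h l \<xi> * coset_symbol a \<gamma> l l' \<xi>))"
      unfolding sum_distrib_left by (rule sum.swap)
    finally show "?F \<omega> \<xi> = (\<Sum>\<gamma>\<in>cube_vertices. (pi_character \<gamma> \<omega> / 2 ^ CARD('d)) * ?C \<gamma> \<xi>)"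
      by simp
  qed
  have ep: "?C j \<in> exppoly UNIV" "?F \<omega> \<in> exppoly UNIV" for j \<omega>
    by (intro exppoly_cmult exppoly_sum exppoly.mult h exppoly_coset_symbol exppoly_fourier_shift)+
  have ev: "?v \<omega> \<in> exppoly UNIV" for \<omega>
    using v exppoly.const by (cases "\<omega> = 0") auto
  show ?thesis
  proof (intro iffI allI ballI)
    fix j assume R: "\<forall>\<omega>\<in>cube_vertices. eq_upto_O N (?F \<omega>) (?v \<omega>)"
    have "eq_upto_O N (\<lambda>\<xi>. \<Sum>\<omega>\<in>cube_vertices. pi_character (- j) \<omega> * ?F \<omega> \<xi>)
        (\<lambda>\<xi>. \<Sum>\<omega>\<in>cube_vertices. pi_character (- j) \<omega> * ?v \<omega> \<xi>)"
      using R ep ev by (intro eq_upto_O_lincomb[of _ _ UNIV]) auto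
    also have "(\<lambda>\<xi>. \<Sum>\<omega>\<in>cube_vertices. pi_character (- j) \<omega> * ?v \<omega> \<xi>) =
        (\<lambda>\<xi>. \<Sum>\<omega>\<in>(cube_vertices :: 'd ivec set). if \<omega> = 0 then v \<xi> else 0)"
      by (intro ext sum.cong) auto
    also have "\<dots> = v"
      by (subst sum.delta[OF finite_cube_vertices]) simp
    finally show "eq_upto_O N (?C j) v"
      unfolding C .
  next
    fix \<omega> :: "'d ivec" assume L: "\<forall>j. eq_upto_O N (?C j) v" and \<omega>: "\<omega> \<in> cube_vertices"
    have "eq_upto_O N (\<lambda>\<xi>. \<Sum>\<gamma>\<in>cube_vertices. (pi_character \<gamma> \<omega> / 2 ^ CARD('d)) * ?C \<gamma> \<xi>)
        (\<lambda>\<xi>. \<Sum>\<gamma>\<in>cube_vertices. (pi_character \<gamma> \<omega> / 2 ^ CARD('d)) * v \<xi>)"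
      using L ep v by (intro eq_upto_O_lincomb[of _ _ UNIV]) auto
    also have "(\<lambda>\<xi>. \<Sum>\<gamma>\<in>cube_vertices. (pi_character \<gamma> \<omega> / 2 ^ CARD('d)) * v \<xi>) =
        (\<lambda>\<xi>. (\<Sum>\<gamma>\<in>cube_vertices. pi_character \<omega> \<gamma>) * v \<xi> / 2 ^ CARD('d))"
      by (simp add: sum_distrib_right sum_divide_distrib pi_character_commute[of _ \<omega>])
    also have "\<dots> = ?v \<omega>"
    proof -
      have "(\<forall>i. even (\<omega> $ i)) \<longleftrightarrow> \<omega> = 0"
      proof
        assume *: "\<forall>i. even (\<omega> $ i)"
        have "\<omega> $ i = 0" for i
          using \<omega> *[THEN spec, of i] by (auto dest!: spec[of _ i])
        then show "\<omega> = 0" by (simp add: vec_eq_iff)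
      qed simp
      then show ?thesis unfolding sum_pi_character by auto
    qed
    finally show "eq_upto_O N (?F \<omega>) (?v \<omega>)"
      unfolding F[OF \<omega>] .
  qed
qed

section \<open>Existence of matching filters\<close>

text \<open>The Lagrange polynomials of the nodes 0, ..., M: the sum and the monomial both have
  degree at most \<open>M\<close> and agree at \<open>M + 1\<close> nodes.\<close>

lemma lagrange_basis:
  obtains L :: "nat \<Rightarrow> real poly"
  where "\<And>n t. n \<le> M \<Longrightarrow> (\<Sum>j\<le>M. real j ^ n * poly (L j) t) = t ^ n"
proof
  define L where "L j = (\<Prod>h\<in>{..M} - {j}. smult (1 / (real j - real h)) [:- real h, 1:])" for j
  have L: "poly (L j) (real i) = (if i = j then 1 else 0)" if "i \<le> M" for i j
  proof (cases "i = j")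
    case False
    then show ?thesis
      using that by (auto simp: L_def poly_prod intro!: prod_zero)
  qed (auto simp: L_def poly_prod intro!: prod.neutral simp flip: diff_divide_distrib)
  have deg: "degree (L j) \<le> M" if "j \<le> M" for j
  proof -
    have "degree (L j) \<le> (\<Sum>h\<in>{..M} - {j}. 1)"
      unfolding L_def by (rule order_trans[OF degree_prod_sum_le]) (auto intro!: sum_mono)
    then show ?thesis using that by simp
  qed
  fix n t assume n: "n \<le> M"
  have "(\<Sum>j\<le>M. smult (real j ^ n) (L j)) = monom 1 n"
  proof (rule poly_eqI_degree)
    have "card (real ` {..M}) = Suc M"
      by (simp add: card_image)
    moreover have "degree (\<Sum>j\<le>M. smult (real j ^ n) (L j)) \<le> M"
      by (rule degree_sum_le) (auto intro: order_trans[OF degree_smult_le] deg)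
    ultimately show "degree (\<Sum>j\<le>M. smult (real j ^ n) (L j)) < card (real ` {..M})"
      "degree (monom (1 :: real) n) < card (real ` {..M})"
      using n by (simp_all add: degree_monom_eq)
  next
    fix x assume "x \<in> real ` {..M}"
    then obtain i where i: "x = real i" "i \<le> M" by auto
    have "poly (\<Sum>j\<le>M. smult (real j ^ n) (L j)) x = (\<Sum>j\<le>M. if j = i then real i ^ n else 0)"
      unfolding i(1) poly_sum by (intro sum.cong) (auto simp: L i(2))
    then show "poly (\<Sum>j\<le>M. smult (real j ^ n) (L j)) x = poly (monom 1 n) x"
      using i by (simp add: poly_monom)
  qed
  then have "poly (\<Sum>j\<le>M. smult (real j ^ n) (L j)) t = poly (monom 1 n) t"
    by simp
  then show "(\<Sum>j\<le>M. real j ^ n * poly (L j) t) = t ^ n"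
    by (simp add: poly_sum poly_monom)
qed

text \<open>A tensor product of one-dimensional bases on the cube {0,...,M}^d. It reproduces the
  monomial because total degree at most \<open>M\<close> bounds each exponent by
  \<open>M\<close>.\<close>

lemma lattice_interpolation:
  obtains K :: "'d::finite ivec set" and L :: "'d ivec \<Rightarrow> 'd rvec \<Rightarrow> complex"
  where "finite K" "\<And>k. L k \<in> exppoly {}"
    "\<And>\<mu> x. mabs \<mu> \<le> M \<Longrightarrow>
      (\<Sum>k\<in>K. complex_of_real (mpower (emb k) \<mu>) * L k x) = complex_of_real (mpower x \<mu>)"
proof -
  obtain \<l> :: "nat \<Rightarrow> real poly"
    where \<l>: "\<And>n t. n \<le> M \<Longrightarrow> (\<Sum>j\<le>M. real j ^ n * poly (\<l> j) t) = t ^ n"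
    using lagrange_basis by blast
  define K :: "'d ivec set" where "K = {k. \<forall>i. k $ i \<in> int ` {..M}}"
  define L :: "'d ivec \<Rightarrow> 'd rvec \<Rightarrow> complex"
    where "L k x = (\<Prod>i\<in>UNIV. complex_of_real (poly (\<l> (nat (k $ i))) (x $ i)))" for k x
  show thesis
  proof
    show "finite K" unfolding K_def by (rule finite_vec_set) simp
    show "L k \<in> exppoly {}" for k
      unfolding L_def[abs_def] poly_altdef of_real_sum of_real_mult of_real_power
      by (intro exppoly_prod exppoly_sum exppoly_cmult exppoly_power exppoly.coord)
    fix \<mu> :: "'d multiindex" and x :: "'d rvec" assume \<mu>: "mabs \<mu> \<le> M"
    have \<mu>i: "\<mu> $ i \<le> M" for i
      using \<mu> member_le_sum[of i UNIV "($) \<mu>"] by (simp add: mabs_def)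
    have "(\<Sum>k\<in>K. complex_of_real (mpower (emb k) \<mu>) * L k x) =
        complex_of_real (\<Sum>k\<in>K. \<Prod>i\<in>UNIV. real_of_int (k $ i) ^ \<mu> $ i * poly (\<l> (nat (k $ i))) (x $ i))"
      by (simp add: mpower_def emb_def L_def prod.distrib)
    also have "\<dots> = complex_of_real (\<Prod>i\<in>UNIV. \<Sum>s\<in>int ` {..M}. real_of_int s ^ \<mu> $ i * poly (\<l> (nat s)) (x $ i))"
      unfolding K_def by (subst sum_prod_vec) simp_all
    also have "\<dots> = complex_of_real (\<Prod>i\<in>UNIV. \<Sum>j\<le>M. real j ^ \<mu> $ i * poly (\<l> j) (x $ i))"
      by (simp add: sum.reindex)
    finally show "(\<Sum>k\<in>K. complex_of_real (mpower (emb k) \<mu>) * L k x) = complex_of_real (mpower x \<mu>)"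
      by (simp only: \<l>[OF \<mu>i] mpower_def)
  qed
qed

lemma hexp_0: "hexp 0 y \<xi> = exp (\<i> * complex_of_real (y \<bullet> \<xi>))"
  by (simp add: hexp_def)

text \<open>The filter takes the values of the functional \<open>p \<mapsto> mdiff (\<nu> l) p (\<tau> l)\<close> on a Lagrange basis
  of the reflected lattice cube, which prescribes all its moments of order at most \<open>M\<close>.\<close>

lemma matching_filter_exists:
  fixes \<nu> :: "'r::finite \<Rightarrow> 'd::{finite,linorder} multiindex"
  obtains \<upsilon> :: "('d, 'r, 1) mseq"
  where "finitely_supported \<upsilon>" "\<And>l. eq_upto_O (M + 1) (\<lambda>\<xi>. fourier \<upsilon> \<xi> $ 1 $ l) (hexp (\<nu> l) (\<tau> l))"
proof -
  obtain K :: "'d ivec set" and L :: "'d ivec \<Rightarrow> 'd rvec \<Rightarrow> complex" where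
    K: "finite K" and L: "\<And>k. L k \<in> exppoly {}" and *: "\<And>\<mu> x. mabs \<mu> \<le> M \<Longrightarrow>
      (\<Sum>k\<in>K. complex_of_real (mpower (emb k) \<mu>) * L k x) = complex_of_real (mpower x \<mu>)"
    using lattice_interpolation by blast
  \<comment> \<open>The reflection turns the minus sign in the exponent of \<open>fourier\<close>
    into the plus sign of \<open>hexp\<close>.\<close>
  define \<upsilon> :: "('d, 'r, 1) mseq"
    where "\<upsilon> k = (if - k \<in> K then \<chi> _ l. mdiff (\<nu> l) (L (- k)) (\<tau> l) else 0)" for k
  have zero: "\<upsilon> k = 0" if "k \<notin> uminus ` K" for k
    using that unfolding \<upsilon>_def by (metis imageI minus_minus)
  have four: "fourier \<upsilon> \<xi> $ 1 $ l = (\<Sum>k\<in>K. mdiff (\<nu> l) (L k) (\<tau> l) * hexp 0 (emb k) \<xi>)" for \<xi> l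
  proof -
    have "fourier \<upsilon> \<xi> $ 1 $ l =
        (\<Sum>k\<in>uminus ` K. \<upsilon> k $ 1 $ l * exp (- (\<i> * complex_of_real (emb k \<bullet> \<xi>))))"
      using K zero by (intro fourier_nth) auto
    also have "\<dots> = (\<Sum>k\<in>K. \<upsilon> (- k) $ 1 $ l * exp (- (\<i> * complex_of_real (emb (- k) \<bullet> \<xi>))))"
      by (subst sum.reindex) (auto simp: inj_on_def)
    also have "\<dots> = (\<Sum>k\<in>K. mdiff (\<nu> l) (L k) (\<tau> l) * hexp 0 (emb k) \<xi>)"
    proof (rule sum.cong[OF refl])
      fix k assume "k \<in> K"
      moreover have "emb (- k) = - emb k" by (simp add: emb_def vec_eq_iff)
      ultimately show "\<upsilon> (- k) $ 1 $ l * exp (- (\<i> * complex_of_real (emb (- k) \<bullet> \<xi>))) =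
          mdiff (\<nu> l) (L k) (\<tau> l) * hexp 0 (emb k) \<xi>"
        by (simp add: \<upsilon>_def hexp_0)
    qed
    finally show ?thesis .
  qed
  show thesis
  proof
    show "finitely_supported \<upsilon>"
      unfolding finitely_supported_def
      using zero by (intro finite_subset[OF _ finite_imageI[OF K, of uminus]]) auto
    fix l
    show "eq_upto_O (M + 1) (\<lambda>\<xi>. fourier \<upsilon> \<xi> $ 1 $ l) (hexp (\<nu> l) (\<tau> l))"
      unfolding eq_upto_O_def
    proof (intro allI impI)
      fix \<mu> :: "'d multiindex" assume "mabs \<mu> < M + 1"
      then have \<mu>: "mabs \<mu> \<le> M" by simp
      have "mdiff \<mu> (\<lambda>\<xi>. fourier \<upsilon> \<xi> $ 1 $ l) 0 =
          (\<Sum>k\<in>K. mdiff (\<nu> l) (L k) (\<tau> l) * mdiff \<mu> (hexp 0 (emb k)) 0)"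
        unfolding four
        by (simp only: mdiff_sum[OF exppoly_cmult[OF exppoly_hexp]] mdiff_cmult[OF exppoly_hexp])
      also have "\<dots> = \<i> ^ mabs \<mu> * (\<Sum>k\<in>K. complex_of_real (mpower (emb k) \<mu>) * mdiff (\<nu> l) (L k) (\<tau> l))"
        by (simp add: mdiff_hexp sum_distrib_left mult_ac)
      \<comment> \<open>With the derivative taken outside, the interpolation identity collapses the
        sum to the monomial, and \<open>mdiff_hexp\<close> is read backwards.\<close>
      also have "\<dots> = \<i> ^ mabs \<mu> * mdiff (\<nu> l) (\<lambda>x. \<Sum>k\<in>K. complex_of_real (mpower (emb k) \<mu>) * L k x) (\<tau> l)"
        by (simp only: mdiff_sum[OF exppoly_cmult[OF L]] mdiff_cmult[OF L])
      finally show "mdiff \<mu> (\<lambda>\<xi>. fourier \<upsilon> \<xi> $ 1 $ l) 0 = mdiff \<mu> (hexp (\<nu> l) (\<tau> l)) 0"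
        by (simp only: *[OF \<mu>] mdiff_hexp)
    qed
  qed
qed

lemma matrix_mult_nth: "(A ** B) $ i $ j = (\<Sum>k\<in>UNIV. A $ i $ k * B $ k $ j)"
  by (simp add: matrix_matrix_mult_def)

text \<open>Multiplication by the symbol of \<open>a\<close> respects jets, so the filter can be
  exchanged for the target. The right-hand side no longer mentions \<open>\<upsilon>\<close>; hence
  all filters with this jet satisfy the sum rules, or none does.\<close>

lemma sum_rules_iff:
  fixes a :: "('d::{finite,linorder}, 'r::finite, 'r) mseq"
  assumes fin: "finitely_supported \<upsilon>"
    and nz: "\<nu> i1 = 0"
    and eq: "\<And>l. eq_upto_O (M + 1) (\<lambda>\<xi>. fourier \<upsilon> \<xi> $ 1 $ l) (hexp (\<nu> l) (\<tau> l))"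
  shows "sum_rules (M + 1) a \<upsilon> \<longleftrightarrow> (\<forall>l'. \<forall>\<omega>\<in>cube_vertices.
    eq_upto_O (M + 1) (\<lambda>\<xi>. \<Sum>l\<in>UNIV. hexp (\<nu> l) (\<tau> l) (2 *\<^sub>R \<xi>) * fourier a (\<xi> + pi *\<^sub>R emb \<omega>) $ l $ l')
       (\<lambda>\<xi>. if \<omega> = 0 then hexp (\<nu> l') (\<tau> l') \<xi> else 0))"
proof -
  \<comment> \<open>Order 0 is among the matched orders since \<open>M + 1 > 0\<close>, and the
    component \<open>i1\<close> of the target is a pure exponential with value 1 at the origin. This
    makes the filter nonzero there.\<close>
  have "mdiff 0 (\<lambda>\<xi>. fourier \<upsilon> \<xi> $ 1 $ i1) 0 = mdiff 0 (hexp (\<nu> i1) (\<tau> i1)) 0"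
    using eq[of i1] unfolding eq_upto_O_def by (metis mabs_0 add_gr_0 zero_less_one)
  then have "fourier \<upsilon> 0 $ 1 $ i1 = 1"
    by (simp add: nz hexp_0)
  then have nonzero: "fourier \<upsilon> 0 \<noteq> 0" by auto
  define U where "U \<omega> l' \<xi> = (\<Sum>l\<in>UNIV. fourier \<upsilon> (2 *\<^sub>R \<xi>) $ 1 $ l * fourier a (\<xi> + pi *\<^sub>R emb \<omega>) $ l $ l')"
    for \<omega> l' \<xi>
  define H where "H \<omega> l' \<xi> = (\<Sum>l\<in>UNIV. hexp (\<nu> l) (\<tau> l) (2 *\<^sub>R \<xi>) * fourier a (\<xi> + pi *\<^sub>R emb \<omega>) $ l $ l')"
    for \<omega> l' \<xi>
  have U: "U \<omega> l' \<in> exppoly UNIV" for \<omega> l'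
    unfolding U_def[abs_def]
    by (intro exppoly_sum exppoly.mult exppoly_fourier_shift exppoly_scale[OF exppoly_fourier])
  have UH: "eq_upto_O (M + 1) (U \<omega> l') (H \<omega> l')" for \<omega> l'
    unfolding U_def[abs_def] H_def[abs_def]
    by (intro eq_upto_O_sum[of _ _ UNIV] eq_upto_O_mult_right[of _ UNIV] exppoly.mult
      exppoly_fourier_shift exppoly_scale[OF exppoly_fourier] exppoly_scale[OF exppoly_hexp]
      eq_upto_O_scale exppoly_fourier exppoly_hexp eq)
  have comp: "(fourier \<upsilon> (2 *\<^sub>R \<xi>) ** fourier a (\<xi> + pi *\<^sub>R emb \<omega>)) $ i $ l' = U \<omega> l' \<xi>" for \<omega> i l' \<xi>
    unfolding matrix_mult_nth U_def num1_eq1[of i] ..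
  have vert: "\<omega> \<in> cube_vertices \<longleftrightarrow> (\<forall>i. 0 \<le> \<omega> $ i \<and> \<omega> $ i \<le> 1)" for \<omega> :: "'d ivec"
  proof -
    have "s \<in> {0, 1} \<longleftrightarrow> 0 \<le> s \<and> s \<le> 1" for s :: int
      by auto
    then show ?thesis by simp
  qed
  have "eq_upto_O (M + 1) (\<lambda>\<xi>. fourier \<upsilon> (2 *\<^sub>R \<xi>) ** fourier a \<xi>) (fourier \<upsilon>) \<longleftrightarrow>
      (\<forall>l'. eq_upto_O (M + 1) (U 0 l') (\<lambda>\<xi>. fourier \<upsilon> \<xi> $ 1 $ l'))"
    using comp[of _ 0] by (subst eq_upto_O_vec[of _ UNIV])
      (simp_all add: U exppoly_fourier forall_1)
  also have "\<dots> \<longleftrightarrow> (\<forall>l'. eq_upto_O (M + 1) (H 0 l') (hexp (\<nu> l') (\<tau> l')))"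
    by (intro all_cong1 eq_upto_O_cong UH eq)
  finally have 0: "eq_upto_O (M + 1) (\<lambda>\<xi>. fourier \<upsilon> (2 *\<^sub>R \<xi>) ** fourier a \<xi>) (fourier \<upsilon>) \<longleftrightarrow>
    (\<forall>l'. eq_upto_O (M + 1) (H 0 l') (hexp (\<nu> l') (\<tau> l')))" .
  have 1: "eq_upto_O (M + 1) (\<lambda>\<xi>. fourier \<upsilon> (2 *\<^sub>R \<xi>) ** fourier a (\<xi> + pi *\<^sub>R emb \<omega>)) (\<lambda>_. 0) \<longleftrightarrow>
      (\<forall>l'. eq_upto_O (M + 1) (H \<omega> l') (\<lambda>_. 0))" for \<omega>
  proof -
    have "eq_upto_O (M + 1) (\<lambda>\<xi>. fourier \<upsilon> (2 *\<^sub>R \<xi>) ** fourier a (\<xi> + pi *\<^sub>R emb \<omega>)) (\<lambda>_. 0) \<longleftrightarrow>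
      (\<forall>l'. eq_upto_O (M + 1) (U \<omega> l') (\<lambda>_. 0))"
      by (subst eq_upto_O_vec[of _ UNIV]) (simp_all add: comp U exppoly.const forall_1)
    also have "\<dots> \<longleftrightarrow> (\<forall>l'. eq_upto_O (M + 1) (H \<omega> l') (\<lambda>_. 0))"
      by (intro all_cong1 eq_upto_O_cong UH eq_upto_O_refl)
    finally show ?thesis .
  qed
  have "sum_rules (M + 1) a \<upsilon> \<longleftrightarrow> (\<forall>l'. eq_upto_O (M + 1) (H 0 l') (hexp (\<nu> l') (\<tau> l'))) \<and>
      (\<forall>\<omega>\<in>cube_vertices. \<omega> \<noteq> 0 \<longrightarrow> (\<forall>l'. eq_upto_O (M + 1) (H \<omega> l') (\<lambda>_. 0)))"
    unfolding sum_rules_def 0 1 Ball_def vert by (simp only: fin nonzero) blast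
  also have "\<dots> \<longleftrightarrow> (\<forall>l'. \<forall>\<omega>\<in>cube_vertices. eq_upto_O (M + 1) (H \<omega> l')
      (\<lambda>\<xi>. if \<omega> = 0 then hexp (\<nu> l') (\<tau> l') \<xi> else 0))" (is "?A \<longleftrightarrow> ?B")
  proof
    assume A: ?A
    show ?B
    proof (intro allI ballI)
      fix l' and \<omega> :: "'d ivec" assume "\<omega> \<in> cube_vertices"
      then show "eq_upto_O (M + 1) (H \<omega> l') (\<lambda>\<xi>. if \<omega> = 0 then hexp (\<nu> l') (\<tau> l') \<xi> else 0)"
        using A by (cases "\<omega> = 0") auto
    qed
  next
    assume B: ?B
    have "(0 :: 'd ivec) \<in> cube_vertices" by simp
    from B[rule_format, OF this] have "eq_upto_O (M + 1) (H 0 l') (hexp (\<nu> l') (\<tau> l'))" for l'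
      by simp
    moreover have "eq_upto_O (M + 1) (H \<omega> l') (\<lambda>_. 0)" if "\<omega> \<in> cube_vertices" "\<omega> \<noteq> 0" for \<omega> l'
      using B[rule_format, OF that(1), of l'] that(2) by simp
    ultimately show ?A by blast
  qed
  finally show ?thesis
    unfolding H_def[abs_def] .
qed

text \<open>One direction uses the filter at hand, the other the one constructed by interpolation;
  in both, the condition on the mask is the same filter-free relation.\<close>

lemma hermite_sum_rules_iff_subdiv:
  fixes a :: "('d::{finite,linorder}, 'r::finite, 'r) mseq"
  assumes "finitely_supported a" "\<nu> i1 = 0"
  shows "hermite_sum_rules (M + 1) \<nu> \<tau> a \<longleftrightarrow>
    (\<forall>p\<in>polys M. subdiv a (hermite_data \<nu> \<tau> p) = hermite_data \<nu> \<tau> (\<lambda>x. p ((1/2) *\<^sub>R x)))"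
    (is "_ \<longleftrightarrow> ?R")
proof -
  have target: "eq_upto_O (M + 1) (fourier \<upsilon>) (\<lambda>\<xi>. \<chi> _ l. \<i> ^ mabs (\<nu> l) * complex_of_real (mpower \<xi> (\<nu> l))
        * exp (\<i> * complex_of_real (\<tau> l \<bullet> \<xi>))) \<longleftrightarrow>
      (\<forall>l. eq_upto_O (M + 1) (\<lambda>\<xi>. fourier \<upsilon> \<xi> $ 1 $ l) (hexp (\<nu> l) (\<tau> l)))" for \<upsilon> :: "('d, 'r, 1) mseq"
    by (subst eq_upto_O_vec[of _ UNIV])
      (simp_all add: exppoly_fourier forall_1 exppoly_hexp flip: hexp_def)
  have R: "?R \<longleftrightarrow> (\<forall>l'. \<forall>\<omega>\<in>cube_vertices.
    eq_upto_O (M + 1) (\<lambda>\<xi>. \<Sum>l\<in>UNIV. hexp (\<nu> l) (\<tau> l) (2 *\<^sub>R \<xi>) * fourier a (\<xi> + pi *\<^sub>R emb \<omega>) $ l $ l')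
       (\<lambda>\<xi>. if \<omega> = 0 then hexp (\<nu> l') (\<tau> l') \<xi> else 0))"
  proof -
    have "?R \<longleftrightarrow> (\<forall>l' j. eq_upto_O (M + 1)
      (\<lambda>\<xi>. 2 ^ CARD('d) * (\<Sum>l\<in>UNIV. hexp (\<nu> l) (\<tau> l) (2 *\<^sub>R \<xi>) * coset_symbol a j l l' \<xi>))
      (hexp (\<nu> l') (\<tau> l')))"
      unfolding subdiv_hermite_data_iff by blast
    also have "\<dots> \<longleftrightarrow> (\<forall>l'. \<forall>\<omega>\<in>cube_vertices.
    eq_upto_O (M + 1) (\<lambda>\<xi>. \<Sum>l\<in>UNIV. hexp (\<nu> l) (\<tau> l) (2 *\<^sub>R \<xi>) * fourier a (\<xi> + pi *\<^sub>R emb \<omega>) $ l $ l')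
       (\<lambda>\<xi>. if \<omega> = 0 then hexp (\<nu> l') (\<tau> l') \<xi> else 0))"
      by (intro all_cong1 coset_relation_iff[where h = "\<lambda>l \<xi>. hexp (\<nu> l) (\<tau> l) (2 *\<^sub>R \<xi>)"]
        assms(1) exppoly_scale exppoly_hexp)
    finally show ?thesis .
  qed
  show ?thesis
  proof
    assume "hermite_sum_rules (M + 1) \<nu> \<tau> a"
    then obtain \<upsilon> where \<upsilon>: "sum_rules (M + 1) a \<upsilon>"
      "\<And>l. eq_upto_O (M + 1) (\<lambda>\<xi>. fourier \<upsilon> \<xi> $ 1 $ l) (hexp (\<nu> l) (\<tau> l))"
      unfolding hermite_sum_rules_def target by blast
    have "finitely_supported \<upsilon>"
      using \<upsilon>(1) by (simp add: sum_rules_def)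
    from sum_rules_iff[OF this assms(2) \<upsilon>(2)] \<upsilon>(1) show ?R
      unfolding R by (rule iffD1)
  next
    assume ?R
    obtain \<upsilon> :: "('d, 'r, 1) mseq" where \<upsilon>: "finitely_supported \<upsilon>"
      "\<And>l. eq_upto_O (M + 1) (\<lambda>\<xi>. fourier \<upsilon> \<xi> $ 1 $ l) (hexp (\<nu> l) (\<tau> l))"
      using matching_filter_exists by blast
    from sum_rules_iff[OF \<upsilon>(1) assms(2) \<upsilon>(2)] \<open>?R\<close>[unfolded R]
    have "sum_rules (M + 1) a \<upsilon>"
      by (rule iffD2)
    then show "hermite_sum_rules (M + 1) \<nu> \<tau> a"
      unfolding hermite_sum_rules_def target using \<upsilon> by blast
  qed
qed

section \<open>From one step to all levels\<close>

lemma polynomial_interpolation_iff_subdiv: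
  fixes \<nu> :: "'r::finite \<Rightarrow> 'd::{finite,linorder} multiindex"
  shows "polynomial_interpolation M \<nu> \<tau> a \<longleftrightarrow>
    (\<forall>p\<in>polys M. subdiv a (hermite_data \<nu> \<tau> p) = hermite_data \<nu> \<tau> (\<lambda>x. p ((1/2) *\<^sub>R x)))"
    (is "_ \<longleftrightarrow> ?R")
proof
  assume L: "polynomial_interpolation M \<nu> \<tau> a"
  show ?R
  proof
    fix p :: "'d rvec \<Rightarrow> complex" assume "p \<in> polys M"
    then have "(subdiv a ^^ 1) (hermite_data \<nu> \<tau> p) = hermite_data \<nu> \<tau> (\<lambda>x. p ((1/2) ^ 1 *\<^sub>R x))"
      using L unfolding polynomial_interpolation_def by blast
    then show "subdiv a (hermite_data \<nu> \<tau> p) = hermite_data \<nu> \<tau> (\<lambda>x. p ((1/2) *\<^sub>R x))"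
      by (simp add: One_nat_def)
  qed
next
  assume R: ?R
  have "(subdiv a ^^ n) (hermite_data \<nu> \<tau> p) = hermite_data \<nu> \<tau> (\<lambda>x. p ((1/2) ^ n *\<^sub>R x))"
    if "p \<in> polys M" for p n
  proof (induction n)
    case (Suc n)
    \<comment> \<open>\<open>polys M\<close> is invariant under dilation, so the one-step identity
      applies to the dilated polynomial.\<close>
    have "subdiv a (hermite_data \<nu> \<tau> (\<lambda>x. p ((1/2) ^ n *\<^sub>R x))) =
        hermite_data \<nu> \<tau> (\<lambda>x. p ((1/2) ^ n *\<^sub>R ((1/2) *\<^sub>R x)))"
      using R polys_scale[OF that, of "(1/2) ^ n"] by blast
    then show ?case using Suc by (simp add: mult.commute)
  qed simp
  then show "polynomial_interpolation M \<nu> \<tau> a"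
    unfolding polynomial_interpolation_def by blast
qed

lemma hermite_data_scale_nth:
  assumes "p \<in> polys M"
  shows "hermite_data \<nu> \<tau> (\<lambda>x. p ((1/2) ^ n *\<^sub>R x)) k $ i $ l =
    ((1/2) ^ mabs (\<nu> l)) ^ n * mdiff (\<nu> l) p ((1/2) ^ n *\<^sub>R (emb k + \<tau> l))"
proof -
  have "((1/2) ^ mabs (\<nu> l)) ^ n = complex_of_real ((1/2) ^ n) ^ mabs (\<nu> l)"
    by (simp only: of_real_power of_real_divide of_real_1 of_real_numeral power_mult[symmetric] mult.commute)
  then show ?thesis
    using mdiff_scale[OF polys_exppoly[OF assms] UNIV_I, of "\<nu> l" "(1/2) ^ n" "emb k + \<tau> l"]
    by (simp only: hermite_data_nth)
qed

lemma hermite_scheme_nth: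
  "hermite_scheme \<nu> a w0 n k $ i $ l = (subdiv a ^^ n) w0 k $ i $ l / ((1/2) ^ mabs (\<nu> l)) ^ n"
proof -
  have "hermite_scheme \<nu> a w0 n k $ i $ l =
      (\<Sum>j\<in>UNIV. if j = l then (subdiv a ^^ n) w0 k $ i $ l * ((1/2) ^ mabs (\<nu> l)) powi (- int n) else 0)"
    unfolding hermite_scheme_def matrix_mult_nth D_power_def by (intro sum.cong) auto
  then show ?thesis
    by (simp only: sum.delta[OF finite] UNIV_I if_True power_int_minus power_int_of_nat divide_inverse)
qed

text \<open>The chain rule for p(2^(-n) x) produces the nonzero factor 2^(-n|\<nu>|) in each
  component, exactly what \<open>D_power \<nu> (- int n)\<close> divides out.\<close>

lemma polynomial_interpolation_iff_scheme:
  "polynomial_interpolation M \<nu> \<tau> a \<longleftrightarrow> scheme_reproduces_polynomials M \<nu> \<tau> a"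
proof -
  have "(subdiv a ^^ n) (hermite_data \<nu> \<tau> p) = hermite_data \<nu> \<tau> (\<lambda>x. p ((1/2) ^ n *\<^sub>R x)) \<longleftrightarrow>
      hermite_scheme \<nu> a (hermite_data \<nu> \<tau> p) n
        = (\<lambda>k. \<chi> _ l. mdiff (\<nu> l) p ((1/2) ^ n *\<^sub>R (emb k + \<tau> l)))" if "p \<in> polys M" for p n
    unfolding fun_eq_iff vec_eq_iff hermite_data_scale_nth[OF that] hermite_scheme_nth
    by (simp add: field_simps)
  then show ?thesis
    unfolding polynomial_interpolation_def scheme_reproduces_polynomials_def by blast
qed

section \<open>Iterated subdivision as a convolution\<close>

lemma matrix_add_rdistrib: "(A + B) ** C = A ** C + B ** (C :: complex ^ 'a ^ 'b::finite)"
  by (simp add: vec_eq_iff matrix_mult_nth distrib_right sum.distrib)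

lemma sum_matrix_mult_left: "(\<Sum>t\<in>S. A t) ** B = (\<Sum>t\<in>S. A t ** (B :: complex ^ 'a ^ 'b::finite))"
  by (induction S rule: infinite_finite_induct) (simp_all add: matrix_add_rdistrib)

lemma sum_matrix_mult_right: "B ** (\<Sum>t\<in>S. A t) = (\<Sum>t\<in>S. B ** (A t :: complex ^ 'a ^ 'b::finite))"
  by (induction S rule: infinite_finite_induct) (simp_all add: matrix_add_ldistrib)

lemma matrix_mult_scaleR_right: "B ** (c *\<^sub>R (A :: complex ^ 'a ^ 'b::finite)) = c *\<^sub>R (B ** A)"
  by (simp add: vec_eq_iff matrix_mult_nth scaleR_sum_right)

lemma matrix_mult_column: "(A ** B) $ i $ j = (A *v column j B) $ i"
  by (simp add: matrix_mult_nth matrix_vector_mult_def column_def)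

lemma mask_bound:
  assumes "finitely_supported a"
  shows "\<exists>R\<ge>0. \<forall>k i. a k \<noteq> 0 \<longrightarrow> \<bar>k $ i\<bar> \<le> R"
proof (intro exI conjI allI impI)
  let ?S = "{k. a k \<noteq> 0}"
  have fin: "finite ?S" using assms by (simp add: finitely_supported_def)
  show "(\<Sum>k\<in>?S. \<Sum>i\<in>UNIV. \<bar>k $ i\<bar>) \<ge> 0" by (intro sum_nonneg) auto
  fix k i assume k: "a k \<noteq> 0"
  have "\<bar>k $ i\<bar> \<le> (\<Sum>i\<in>UNIV. \<bar>k $ i\<bar>)" by (rule member_le_sum) auto
  also have "\<dots> \<le> (\<Sum>k\<in>?S. \<Sum>i\<in>UNIV. \<bar>k $ i\<bar>)"
    using k fin by (intro member_le_sum[of k ?S "\<lambda>k. \<Sum>i\<in>UNIV. \<bar>k $ i\<bar>"]) (auto intro: sum_nonneg)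
  finally show "\<bar>k $ i\<bar> \<le> (\<Sum>k\<in>?S. \<Sum>i\<in>UNIV. \<bar>k $ i\<bar>)" .
qed

text \<open>The radius obeys r' = 2 r + R starting from 0, whose solution is (2^n - 1) R.\<close>

lemma iterated_mask_support:
  fixes a :: "('d::finite, 'r::finite, 'r) mseq"
  assumes "\<And>k i. a k \<noteq> 0 \<Longrightarrow> \<bar>k $ i\<bar> \<le> R" "(subdiv a ^^ n) delta_mat j \<noteq> 0"
  shows "\<bar>j $ i\<bar> \<le> (2 ^ n - 1) * R"
  using assms(2)
proof (induction n arbitrary: j)
  case 0
  then show ?case by (auto simp: delta_mat_def split: if_splits)
next
  case (Suc n)
  have "\<exists>k. a (j - 2 *s k) \<noteq> 0 \<and> (subdiv a ^^ n) delta_mat k \<noteq> 0"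
  proof (rule ccontr)
    assume "\<not> ?thesis"
    then have "(\<Sum>k | a (j - 2 *s k) \<noteq> 0. (subdiv a ^^ n) delta_mat k ** a (j - 2 *s k)) = 0"
      by (intro sum.neutral) auto
    then have "(subdiv a ^^ Suc n) delta_mat j = 0"
      by (simp add: subdiv_def)
    with Suc.prems show False by blast
  qed
  then obtain k where k: "a (j - 2 *s k) \<noteq> 0" "(subdiv a ^^ n) delta_mat k \<noteq> 0" by blast
  have "\<bar>j $ i - 2 * k $ i\<bar> \<le> R" using assms(1)[OF k(1), of i] by simp
  moreover have "\<bar>k $ i\<bar> \<le> (2 ^ n - 1) * R" using Suc.IH[OF k(2)] .
  ultimately show ?case by (simp add: algebra_simps)
qed

lemma finite_lattice_box: "finite (lattice_box R :: 'd::finite ivec set)"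
proof -
  have "finite {s :: int. \<bar>real_of_int s\<bar> \<le> R}"
  proof (rule finite_subset)
    show "{s :: int. \<bar>real_of_int s\<bar> \<le> R} \<subseteq> {- \<lceil>R\<rceil>..\<lceil>R\<rceil>}"
    proof
      fix s :: int assume "s \<in> {s. \<bar>real_of_int s\<bar> \<le> R}"
      then have "s \<le> \<lceil>R\<rceil>" "- s \<le> \<lceil>R\<rceil>" by (simp, linarith)+
      then show "s \<in> {- \<lceil>R\<rceil>..\<lceil>R\<rceil>}" by simp
    qed
  qed simp
  then show ?thesis
    using finite_vec_set[of "\<lambda>_. {s :: int. \<bar>real_of_int s\<bar> \<le> R}"] by (simp add: lattice_box_def)
qed

lemma finitely_supported_iterated_mask:
  fixes a :: "('d::finite, 'r::finite, 'r) mseq"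
  assumes "finitely_supported a"
  shows "finitely_supported ((subdiv a ^^ n) delta_mat)"
proof -
  obtain R where R: "\<And>k i. a k \<noteq> 0 \<Longrightarrow> \<bar>k $ i\<bar> \<le> R"
    using mask_bound[OF assms] by metis
  have "{j. (subdiv a ^^ n) delta_mat j \<noteq> 0} \<subseteq> lattice_box (of_int ((2 ^ n - 1) * R))"
  proof
    fix j assume "j \<in> {j. (subdiv a ^^ n) delta_mat j \<noteq> 0}"
    then have "(subdiv a ^^ n) delta_mat j \<noteq> 0" by blast
    from iterated_mask_support[OF R this] have "\<bar>j $ i\<bar> \<le> (2 ^ n - 1) * R" for i .
    then show "j \<in> lattice_box (of_int ((2 ^ n - 1) * R))"
      unfolding lattice_box_def of_int_abs[symmetric] of_int_le_iff by simp
  qed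
  then show ?thesis
    unfolding finitely_supported_def by (rule finite_subset[OF _ finite_lattice_box])
qed

text \<open>Shifting the input by \<open>h\<close> shifts the output by \<open>2 h\<close>;
  iterated, this gives the step 2^n in the convolution formula.\<close>

lemma subdiv_shift:
  fixes a :: "('d::finite, 'r::finite, 'r) mseq"
  shows "subdiv a v (j - 2 *s h) =
    2 ^ CARD('d) *\<^sub>R (\<Sum>k | a (j - 2 *s k) \<noteq> 0. v (k - h) ** a (j - 2 *s k))"
proof -
  have eq: "j - 2 *s (k + h) = j - 2 *s h - 2 *s k" for k
    by (simp add: vec_eq_iff)
  have set_eq: "{k. a (j - 2 *s k) \<noteq> 0} = (\<lambda>k. k + h) ` {k. a (j - 2 *s h - 2 *s k) \<noteq> 0}"
  proof (intro equalityI subsetI)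
    fix k assume "k \<in> {k. a (j - 2 *s k) \<noteq> 0}"
    then show "k \<in> (\<lambda>k. k + h) ` {k. a (j - 2 *s h - 2 *s k) \<noteq> 0}"
      using eq[of "k - h"] by (intro image_eqI[of _ _ "k - h"]) simp_all
  next
    fix k assume "k \<in> (\<lambda>k. k + h) ` {k. a (j - 2 *s h - 2 *s k) \<noteq> 0}"
    then obtain k' where "k = k' + h" "a (j - 2 *s h - 2 *s k') \<noteq> 0" by blast
    then show "k \<in> {k. a (j - 2 *s k) \<noteq> 0}" by (simp only: mem_Collect_eq eq simp_thms)
  qed
  have "(\<Sum>k | a (j - 2 *s k) \<noteq> 0. v (k - h) ** a (j - 2 *s k)) =
      (\<Sum>k | a (j - 2 *s h - 2 *s k) \<noteq> 0. v k ** a (j - 2 *s h - 2 *s k))"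
  proof (rule sum.reindex_cong[OF _ set_eq])
    show "inj_on (\<lambda>k. k + h) {k. a (j - 2 *s h - 2 *s k) \<noteq> 0}" by simp
  qed (simp only: eq add_diff_cancel_right')
  then show ?thesis unfolding subdiv_def by simp
qed

text \<open>The data \<open>w\<close> may have infinite support, so the sum runs over any finite
  \<open>H\<close> off which the iterated mask vanishes.\<close>

lemma iterated_subdiv_convolution:
  fixes a :: "('d::finite, 'r::finite, 'r) mseq" and w :: "('d, 'r, 's::finite) mseq"
  assumes fin: "finitely_supported a"
    and "finite H" "\<And>h. h \<notin> H \<Longrightarrow> (subdiv a ^^ n) delta_mat (j - 2 ^ n *s h) = 0"
  shows "(subdiv a ^^ n) w j = (\<Sum>h\<in>H. w h ** (subdiv a ^^ n) delta_mat (j - 2 ^ n *s h))"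
  using assms(2,3)
proof (induction n arbitrary: j H)
  case 0
  have "(mat 1 :: complex ^ 'r ^ 'r) \<noteq> 0"
    by (auto simp: vec_eq_iff mat_def)
  \<comment> \<open>At level 0 the mask is the identity matrix at the origin, so the hypothesis on
    \<open>H\<close> forces \<open>j\<close> into it.\<close>
  then have "j \<in> H"
    using 0(2)[of j] by (auto simp: delta_mat_def)
  have "(\<Sum>h\<in>H. w h ** delta_mat (j - h)) = (\<Sum>h\<in>H. if h = j then w j else 0)"
    by (intro sum.cong) (auto simp: delta_mat_def)
  then show ?case using 0(1) \<open>j \<in> H\<close> by simp
next
  case (Suc n)
  let ?P = "\<lambda>n. (subdiv a ^^ n) delta_mat"
  let ?K = "{k. a (j - 2 *s k) \<noteq> 0}"
  \<comment> \<open>Enlarged so that the induction hypothesis applies with one index set to every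
    \<open>k\<close> in the stencil; the surplus terms vanish at the next level by the hypothesis on
    \<open>H\<close>.\<close>
  define H' where "H' = H \<union> (\<Union>k\<in>?K. {h. ?P n (k - 2 ^ n *s h) \<noteq> 0})"
  have H': "finite H'"
    unfolding H'_def using Suc.prems(1) finite_mask_support[OF fin, of 2 j]
      finite_mask_support[OF finitely_supported_iterated_mask[OF fin], of "2 ^ n"] by simp
  have pow: "2 ^ Suc n *s h = 2 *s (2 ^ n *s h)" for h :: "'d ivec"
    by (simp add: vec_eq_iff)
  have P: "?P (Suc n) (j - 2 ^ Suc n *s h) =
      2 ^ CARD('d) *\<^sub>R (\<Sum>k\<in>?K. ?P n (k - 2 ^ n *s h) ** a (j - 2 *s k))" for h
    unfolding pow funpow.simps comp_apply by (rule subdiv_shift)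
  have "(subdiv a ^^ Suc n) w j = 2 ^ CARD('d) *\<^sub>R (\<Sum>k\<in>?K. (subdiv a ^^ n) w k ** a (j - 2 *s k))"
    unfolding funpow.simps comp_apply by (rule subdiv_def[THEN fun_cong])
  also have "\<dots> = 2 ^ CARD('d) *\<^sub>R (\<Sum>k\<in>?K. \<Sum>h\<in>H'. w h ** (?P n (k - 2 ^ n *s h) ** a (j - 2 *s k)))"
  proof -
    have "(subdiv a ^^ n) w k = (\<Sum>h\<in>H'. w h ** ?P n (k - 2 ^ n *s h))" if "k \<in> ?K" for k
      using that by (intro Suc.IH[OF H']) (auto simp: H'_def)
    then have "(subdiv a ^^ n) w k ** a (j - 2 *s k) =
        (\<Sum>h\<in>H'. w h ** (?P n (k - 2 ^ n *s h) ** a (j - 2 *s k)))" if "k \<in> ?K" for k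
      using that by (simp only: sum_matrix_mult_left matrix_mul_assoc)
    then show ?thesis
      by (intro arg_cong[of _ _ "scaleR _"] sum.cong refl)
  qed
  also have "\<dots> = 2 ^ CARD('d) *\<^sub>R (\<Sum>h\<in>H'. w h ** (\<Sum>k\<in>?K. ?P n (k - 2 ^ n *s h) ** a (j - 2 *s k)))"
    unfolding sum_matrix_mult_right by (subst sum.swap) (rule refl)
  also have "\<dots> = (\<Sum>h\<in>H'. w h ** ?P (Suc n) (j - 2 ^ Suc n *s h))"
    unfolding P matrix_mult_scaleR_right by (rule scaleR_sum_right)
  also have "\<dots> = (\<Sum>h\<in>H. w h ** ?P (Suc n) (j - 2 ^ Suc n *s h))"
  proof (rule sum.mono_neutral_right[OF H'])
    show "H \<subseteq> H'" by (auto simp: H'_def)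
    show "\<forall>h\<in>H' - H. w h ** ?P (Suc n) (j - 2 ^ Suc n *s h) = 0"
    proof
      fix h assume "h \<in> H' - H"
      then have "?P (Suc n) (j - 2 ^ Suc n *s h) = 0" by (intro Suc.prems(2)) blast
      then show "w h ** ?P (Suc n) (j - 2 ^ Suc n *s h) = 0" by (simp only: times0_right)
    qed
  qed
  finally show ?case .
qed

section \<open>The basis vector function\<close>

lemma dyadic_approximation:
  "(\<lambda>n. (1/2) ^ n *\<^sub>R emb (\<chi> i. \<lfloor>2 ^ n * x $ i\<rfloor>)) \<longlonglongrightarrow> x"
proof (rule vec_tendstoI)
  fix i
  have bound: "norm ((1/2) ^ n * of_int \<lfloor>2 ^ n * x $ i\<rfloor> - x $ i) \<le> (1/2) ^ n" for n
  proof -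
    define y where "y = 2 ^ n * x $ i"
    have "(1/2 :: real) ^ n * 2 ^ n = 1"
      by (simp flip: power_mult_distrib)
    then have "(1/2) ^ n * of_int \<lfloor>y\<rfloor> - x $ i = (1/2) ^ n * (of_int \<lfloor>y\<rfloor> - y)"
      unfolding y_def right_diff_distrib mult.assoc[symmetric] by (simp only: mult_1_left)
    also have "norm \<dots> = (1/2) ^ n * \<bar>of_int \<lfloor>y\<rfloor> - y\<bar>"
      by (simp add: abs_mult)
    also have "\<dots> \<le> (1/2) ^ n * 1"
    proof (rule mult_left_mono)
      show "\<bar>of_int \<lfloor>y\<rfloor> - y\<bar> \<le> 1" using floor_correct[of y] by linarith
    qed simp
    finally show ?thesis by (simp add: y_def)
  qed
  have "(\<lambda>n. (1/2) ^ n :: real) \<longlonglongrightarrow> 0"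
    by (rule LIMSEQ_power_zero) simp
  from Lim_null_comparison[OF always_eventually[OF allI[OF bound]] this]
  have "(\<lambda>n. (1/2) ^ n * of_int \<lfloor>2 ^ n * x $ i\<rfloor> - x $ i) \<longlonglongrightarrow> 0" .
  from LIM_zero_cancel[OF this]
  show "(\<lambda>n. ((1/2) ^ n *\<^sub>R emb (\<chi> i. \<lfloor>2 ^ n * x $ i\<rfloor>)) $ i) \<longlonglongrightarrow> x $ i"
    by (simp add: emb_def)
qed

text \<open>The approximating dyadic points lie in the open set \<open>U\<close> eventually, so
  agreement on its dyadic points is enough.\<close>

lemma eq_on_dyadics:
  fixes f g :: "'d::finite rvec \<Rightarrow> complex"
  assumes "continuous_on UNIV f" "continuous_on UNIV g" "open U" "x \<in> U"
    and "\<And>n k. (1/2) ^ n *\<^sub>R emb k \<in> U \<Longrightarrow> f ((1/2) ^ n *\<^sub>R emb k) = g ((1/2) ^ n *\<^sub>R emb k)"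
  shows "f x = g x"
proof -
  define s where "s n = (1/2) ^ n *\<^sub>R emb (\<chi> i. \<lfloor>2 ^ n * x $ i\<rfloor>)" for n :: nat
  have s: "s \<longlonglongrightarrow> x"
    unfolding s_def by (rule dyadic_approximation)
  have f: "(\<lambda>n. f (s n)) \<longlonglongrightarrow> f x"
    by (rule continuous_on_tendsto_compose[OF assms(1) s]) simp_all
  have "(\<lambda>n. g (s n)) \<longlonglongrightarrow> g x"
    by (rule continuous_on_tendsto_compose[OF assms(2) s]) simp_all
  moreover have "eventually (\<lambda>n. g (s n) = f (s n)) sequentially"
    using topological_tendstoD[OF s assms(3,4)]
  proof eventually_elim
    case (elim n)
    then show ?case unfolding s_def by (rule assms(5)[symmetric])
  qed
  ultimately have "(\<lambda>n. f (s n)) \<longlonglongrightarrow> g x"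
    by (rule Lim_transform_eventually)
  with f show ?thesis by (rule LIMSEQ_unique)
qed

context
  fixes m :: nat and i1 :: "'r::finite" and a :: "('d::{finite,linorder}, 'r, 'r) mseq"
    and \<phi> :: "'d rvec \<Rightarrow> complex ^ 'r" and R :: int
  assumes basis: "basis_vector_function m i1 a \<phi>"
    and fin: "finitely_supported a"
    and R: "R \<ge> 0" "\<And>k i. a k \<noteq> 0 \<Longrightarrow> \<bar>k $ i\<bar> \<le> R"
begin

lemma continuous_basis: "continuous_on UNIV \<phi>"
proof -
  have "continuous_on UNIV (\<lambda>x. \<phi> x $ j)" for j
    using basis unfolding basis_vector_function_def by (metis Cm.simps not0_implies_Suc)
  then have "continuous_on UNIV (\<lambda>x. \<chi> j. \<phi> x $ j)"
    by (rule continuous_on_vec_lambda)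
  then show ?thesis by simp
qed

text \<open>The dyadic point of level \<open>n0\<close> and index \<open>k\<close> has index 2^n k
  at level \<open>n0 + n\<close>, so the uniform limit can be read along a fixed point.\<close>

lemma basis_limit:
  "(\<lambda>n. column i1 ((subdiv a ^^ (n0 + n)) delta_mat (2 ^ n *s k)))
    \<longlonglongrightarrow> \<phi> ((1/2) ^ n0 *\<^sub>R emb k)"
proof -
  let ?e = "\<lambda>n k. norm (column i1 ((subdiv a ^^ n) delta_mat k) - \<phi> ((1/2) ^ n *\<^sub>R emb k))"
  have "(\<lambda>n. SUP k. ennreal (?e n k)) \<longlonglongrightarrow> 0"
    using basis unfolding basis_vector_function_def by blast
  then have "(\<lambda>n. SUP k. ennreal (?e (n0 + n) k)) \<longlonglongrightarrow> 0"
    unfolding add.commute[of n0] by (rule LIMSEQ_ignore_initial_segment)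
  then have "(\<lambda>n. ennreal (?e (n0 + n) (2 ^ n *s k))) \<longlonglongrightarrow> 0"
    by (rule tendsto_sandwich[OF _ _ tendsto_const, rotated 2]) (auto intro!: always_eventually SUP_upper)
  then have "(\<lambda>n. ?e (n0 + n) (2 ^ n *s k)) \<longlonglongrightarrow> 0"
    by (simp add: ennreal_0[symmetric] del: ennreal_0)
  moreover have "(1/2) ^ (n0 + n) *\<^sub>R emb (2 ^ n *s k) = (1/2) ^ n0 *\<^sub>R emb k" for n
    by (simp add: emb_scale power_add power_one_over)
  ultimately show ?thesis
    by (simp add: tendsto_norm_zero_iff LIM_zero_iff)
qed

lemma iterated_mask_zero:
  assumes "2 ^ n * real_of_int R < \<bar>real_of_int (j $ i)\<bar>"
  shows "(subdiv a ^^ n) delta_mat j = 0"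
proof (rule ccontr)
  assume "(subdiv a ^^ n) delta_mat j \<noteq> 0"
  from iterated_mask_support[OF R(2) this] have "\<bar>j $ i\<bar> \<le> (2 ^ n - 1) * R" .
  also have "\<dots> \<le> 2 ^ n * R" using R(1) by (simp add: algebra_simps)
  finally have "real_of_int \<bar>j $ i\<bar> \<le> real_of_int (2 ^ n * R)" by linarith
  with assms show False by simp
qed

text \<open>The iterated masks vanish at scaled distance beyond \<open>R\<close>, which makes \<phi>
  zero at dyadic points there. Strict inequality gives an open set, and continuity does the
  rest.\<close>

lemma basis_support:
  assumes "\<bar>x $ i\<bar> > of_int R"
  shows "\<phi> x = 0"
proof -
  have "\<phi> x $ j = 0" for j
  proof (rule eq_on_dyadics[where U = "{x. of_int R < \<bar>x $ i\<bar>}"])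
    show "open {x :: 'd rvec. of_int R < \<bar>x $ i\<bar>}"
      by (intro open_Collect_less continuous_intros)
    fix n0 k assume *: "(1/2) ^ n0 *\<^sub>R emb k \<in> {x :: 'd rvec. of_int R < \<bar>x $ i\<bar>}"
    have "(subdiv a ^^ (n0 + n)) delta_mat (2 ^ n *s k) = 0" for n
    proof (rule iterated_mask_zero)
      have "of_int R < \<bar>real_of_int (k $ i)\<bar> / 2 ^ n0"
        using * by (simp add: emb_def abs_mult power_one_over)
      then show "2 ^ (n0 + n) * real_of_int R < \<bar>real_of_int ((2 ^ n *s k) $ i)\<bar>"
        by (simp add: abs_mult power_add field_simps)
    qed
    then have "(\<lambda>n. 0) \<longlonglongrightarrow> \<phi> ((1/2) ^ n0 *\<^sub>R emb k)"
      using basis_limit[of n0 k] by (simp add: column_def zero_vec_def)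
    then show "\<phi> ((1/2) ^ n0 *\<^sub>R emb k) $ j = 0"
      by (simp add: LIMSEQ_const_iff)
  qed (use assms continuous_basis in \<open>auto intro: continuous_intros\<close>)
  then show ?thesis by (simp add: vec_eq_iff)
qed

text \<open>Compact support reduces \<open>infsum\<close> to a finite sum over a box that depends on
  \<open>x\<close> only through the bound \<open>B\<close>.\<close>

lemma conv_basis_finite:
  assumes "\<And>i. \<bar>x $ i\<bar> \<le> B"
  shows "conv_basis w \<phi> x = (\<Sum>k\<in>lattice_box (of_int R + B). (w k *v \<phi> (x - emb k)) $ 1)"
proof -
  have "\<phi> (x - emb k) = 0" if "k \<notin> lattice_box (of_int R + B)" for k
  proof -
    have "\<exists>i. \<bar>real_of_int (k $ i)\<bar> > of_int R + B"
      using that by (simp add: lattice_box_def not_le)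
    then obtain i where "\<bar>real_of_int (k $ i)\<bar> > of_int R + B" ..
    then show ?thesis
      using assms[of i] by (intro basis_support[of _ i]) (simp add: emb_def)
  qed
  then have "conv_basis w \<phi> x = (\<Sum>\<^sub>\<infinity>k\<in>lattice_box (of_int R + B). (w k *v \<phi> (x - emb k)) $ 1)"
    unfolding conv_basis_def by (intro infsum_cong_neutral) auto
  then show ?thesis by (simp add: infsum_finite finite_lattice_box)
qed

lemma conv_basis_hermite_data:
  fixes \<nu> :: "'r \<Rightarrow> 'd multiindex"
  assumes "polynomial_interpolation M \<nu> \<tau> a" "\<nu> i1 = 0" "p \<in> polys M"
  shows "conv_basis (hermite_data \<nu> \<tau> p) \<phi> = p"
proof
  fix x :: "'d rvec"
  define w where "w = hermite_data \<nu> \<tau> p"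
  \<comment> \<open>The open ball of this radius contains \<open>x\<close>, and \<open>H\<close>
    then serves all its points, so that \<open>g\<close> is a fixed finite sum of continuous
    functions.\<close>
  define B where "B = norm x + 1"
  define H :: "'d ivec set" where "H = lattice_box (of_int R + B)"
  have B: "\<bar>y $ i\<bar> \<le> B" if "y \<in> ball 0 B" for y :: "'d rvec" and i
    using that component_le_norm_cart[of y i] by simp
  define g where "g y = (\<Sum>h\<in>H. (w h *v \<phi> (y - emb h)) $ 1)" for y
  have "conv_basis w \<phi> x = g x"
    unfolding g_def H_def by (rule conv_basis_finite, rule B) (simp add: B_def)
  also have "g x = p x"
  proof (rule eq_on_dyadics[where U = "ball 0 B"])
    show "continuous_on UNIV g"
      unfolding g_def matrix_vector_mult_def
      by (auto intro!: continuous_intros continuous_on_compose2[OF continuous_basis])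
    show cont_p: "continuous_on UNIV p"
      using polys_exppoly[OF assms(3)] by (rule exppoly_continuous)
    fix n0 k assume y: "(1/2) ^ n0 *\<^sub>R emb k \<in> ball (0 :: 'd rvec) B"
    define y :: "'d rvec" where "y = (1/2) ^ n0 *\<^sub>R emb k"
    have scale: "(1/2) ^ (n0 + n) *\<^sub>R emb (2 ^ n *s k) = y" for n
      by (simp add: y_def emb_scale power_add power_one_over)
    \<comment> \<open>As \<open>\<nu> i1 = 0\<close>, no derivative and no scaling factor appear;
      the shift by \<open>\<tau> i1\<close> shrinks with the level.\<close>
    have "(subdiv a ^^ (n0 + n)) w (2 ^ n *s k) $ 1 $ i1 = p (y + (1/2) ^ (n0 + n) *\<^sub>R \<tau> i1)" for n
    proof -
      have "(subdiv a ^^ (n0 + n)) w = hermite_data \<nu> \<tau> (\<lambda>x. p ((1/2) ^ (n0 + n) *\<^sub>R x))"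
        using assms(1,3) unfolding polynomial_interpolation_def w_def by blast
      then show ?thesis
        using assms(2) by (simp add: scaleR_add_right scale)
    qed
    moreover have "(\<lambda>n. p (y + (1/2) ^ (n0 + n) *\<^sub>R \<tau> i1)) \<longlonglongrightarrow> p y"
    proof (rule continuous_on_tendsto_compose[OF cont_p])
      have "(\<lambda>n. y + ((1/2) ^ n0 * (1/2) ^ n) *\<^sub>R \<tau> i1) \<longlonglongrightarrow> y + ((1/2) ^ n0 * 0) *\<^sub>R \<tau> i1"
        by (intro tendsto_intros) simp_all
      then show "(\<lambda>n. y + (1/2) ^ (n0 + n) *\<^sub>R \<tau> i1) \<longlonglongrightarrow> y"
        by (simp add: power_add)
    qed auto
    ultimately have "(\<lambda>n. (subdiv a ^^ (n0 + n)) w (2 ^ n *s k) $ 1 $ i1) \<longlonglongrightarrow> p y"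
      by simp
    \<comment> \<open>The same sequence written as a convolution over \<open>H\<close>;
      \<open>basis_limit\<close> applies term by term.\<close>
    moreover have "(\<lambda>n. (subdiv a ^^ (n0 + n)) w (2 ^ n *s k) $ 1 $ i1) \<longlonglongrightarrow> g y"
    proof -
      have diff: "2 ^ n *s k - 2 ^ (n0 + n) *s h = 2 ^ n *s (k - 2 ^ n0 *s h)" for n h
        by (simp add: vec_eq_iff power_add algebra_simps)
      have "(subdiv a ^^ (n0 + n)) w (2 ^ n *s k) =
          (\<Sum>h\<in>H. w h ** (subdiv a ^^ (n0 + n)) delta_mat (2 ^ n *s k - 2 ^ (n0 + n) *s h))" for n
      proof (rule iterated_subdiv_convolution[OF fin])
        show "finite H" unfolding H_def by (rule finite_lattice_box)
        fix h assume "h \<notin> H"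
        then have "\<exists>i. \<bar>real_of_int (h $ i)\<bar> > of_int R + B"
          by (simp add: H_def lattice_box_def not_le)
        then obtain i where i: "\<bar>real_of_int (h $ i)\<bar> > of_int R + B" ..
        have "\<bar>y $ i\<bar> \<le> B" unfolding y_def by (rule B[OF y])
        with i have "\<bar>y $ i - real_of_int (h $ i)\<bar> > of_int R" by linarith
        then have "2 ^ (n0 + n) * real_of_int R < 2 ^ (n0 + n) * \<bar>y $ i - real_of_int (h $ i)\<bar>"
          by (intro mult_strict_left_mono) simp_all
        also have "\<dots> = \<bar>real_of_int ((2 ^ n *s k - 2 ^ (n0 + n) *s h) $ i)\<bar>"
        proof -
          have "2 ^ (n0 + n) * y $ i = 2 ^ n * real_of_int (k $ i)"
            by (simp add: y_def emb_def power_add power_one_over)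
          then have "real_of_int ((2 ^ n *s k - 2 ^ (n0 + n) *s h) $ i) =
              2 ^ (n0 + n) * (y $ i - real_of_int (h $ i))"
            by (simp add: right_diff_distrib)
          then show ?thesis by (simp only: abs_mult) simp
        qed
        finally show "(subdiv a ^^ (n0 + n)) delta_mat (2 ^ n *s k - 2 ^ (n0 + n) *s h) = 0"
          by (rule iterated_mask_zero)
      qed
      then have "(subdiv a ^^ (n0 + n)) w (2 ^ n *s k) $ 1 $ i1 = (\<Sum>h\<in>H.
          (w h *v column i1 ((subdiv a ^^ (n0 + n)) delta_mat (2 ^ n *s (k - 2 ^ n0 *s h)))) $ 1)" for n
        by (simp only: diff sum_component matrix_mult_column)
      moreover have "(\<lambda>n. (\<Sum>h\<in>H.
          (w h *v column i1 ((subdiv a ^^ (n0 + n)) delta_mat (2 ^ n *s (k - 2 ^ n0 *s h)))) $ 1))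
          \<longlonglongrightarrow> (\<Sum>h\<in>H. (w h *v \<phi> ((1/2) ^ n0 *\<^sub>R emb (k - 2 ^ n0 *s h))) $ 1)"
        unfolding matrix_vector_mult_def vec_lambda_beta
        by (intro tendsto_sum tendsto_mult tendsto_const tendsto_vec_nth basis_limit)
      moreover have "(1/2) ^ n0 *\<^sub>R emb (k - 2 ^ n0 *s h) = y - emb h" for h
        by (simp add: y_def emb_diff emb_scale power_one_over scaleR_diff_right)
      ultimately show ?thesis
        by (simp only: g_def)
    qed
    ultimately show "g ((1/2) ^ n0 *\<^sub>R emb k) = p ((1/2) ^ n0 *\<^sub>R emb k)"
      unfolding y_def[symmetric] using LIMSEQ_unique by blast
  qed (simp_all add: B_def)
  finally show "conv_basis (hermite_data \<nu> \<tau> p) \<phi> x = p x"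
    unfolding w_def .
qed

end

lemma polys_mdiff_affine:
  assumes "p \<in> polys M"
  shows "\<exists>N. (\<lambda>x. mdiff \<alpha> p (c *\<^sub>R (x + b))) \<in> polys N"
proof -
  have "mdiff \<alpha> p \<in> exppoly {}"
    using assms by (intro exppoly_mdiff polys_exppoly)
  then have "(\<lambda>x. mdiff \<alpha> p (c *\<^sub>R x + c *\<^sub>R b)) \<in> exppoly {}"
    by (rule exppoly_affine) simp
  then show ?thesis
    by (intro exppoly_empty_polys) (simp add: scaleR_add_right)
qed

text \<open>After adding \<open>\<tau> (\<theta> l)\<close> the argument at level \<open>n\<close>
  is twice the one at level \<open>n - 1\<close>, and equality of \<open>\<nu> (\<theta> l)\<close>
  and \<open>\<nu> l\<close> makes the two components the same derivative of
  \<open>p\<close>.\<close>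

lemma scheme_component_relation:
  fixes \<nu> :: "'r::finite \<Rightarrow> 'd::{finite,linorder} multiindex"
  assumes "scheme_reproduces_polynomials M \<nu> \<tau> a" "p \<in> polys M" "\<And>l. \<nu> (\<theta> l) = \<nu> l"
  defines "w \<equiv> hermite_scheme \<nu> a (hermite_data \<nu> \<tau> p)"
  shows "\<exists>W. (\<forall>n. vector_polynomial_extension (w n) (W n)) \<and>
    (\<forall>k. \<forall>n\<ge>1. \<forall>l. W n (2 *\<^sub>R emb k + 2 *\<^sub>R \<tau> l - \<tau> (\<theta> l)) $ 1 $ \<theta> l = w (n - 1) k $ 1 $ l)"
proof -
  have w: "w n = (\<lambda>k. \<chi> _ l. mdiff (\<nu> l) p ((1/2) ^ n *\<^sub>R (emb k + \<tau> l)))" for n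
    using assms(1,2) unfolding scheme_reproduces_polynomials_def w_def by blast
  \<comment> \<open>The reproduction formula read at real arguments, since
    \<open>2 k + 2 \<tau> l - \<tau> (\<theta> l)\<close> may lie off the lattice.\<close>
  define W :: "nat \<Rightarrow> 'd rvec \<Rightarrow> complex ^ 'r ^ 1"
    where "W n x = (\<chi> _ l. mdiff (\<nu> l) p ((1/2) ^ n *\<^sub>R (x + \<tau> l)))" for n x
  have "vector_polynomial_extension (w n) (W n)" for n
    unfolding vector_polynomial_extension_def W_def w
    using polys_mdiff_affine[OF assms(2)] by simp
  moreover have "W n (2 *\<^sub>R emb k + 2 *\<^sub>R \<tau> l - \<tau> (\<theta> l)) $ 1 $ \<theta> l = w (n - 1) k $ 1 $ l"
    if n1: "n \<ge> 1" for k n l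
  proof -
    obtain n' where n: "n = Suc n'"
      using n1 by (cases n) auto
    have "(1/2) ^ n *\<^sub>R (2 *\<^sub>R emb k + 2 *\<^sub>R \<tau> l - \<tau> (\<theta> l) + \<tau> (\<theta> l)) =
        (1/2) ^ n' *\<^sub>R (emb k + \<tau> l)"
      unfolding n by (simp add: scaleR_add_right)
    then show ?thesis
      unfolding w W_def by (simp only: vec_lambda_beta assms(3) n diff_Suc_1)
  qed
  ultimately show ?thesis by blast
qed

theorem theorem4p2:
  fixes m M :: nat
    and i1 :: "'r::finite"
    and \<nu> :: "'r \<Rightarrow> 'd::{finite,linorder} multiindex"
    and \<tau> :: "'r \<Rightarrow> 'd rvec"
    and a :: "('d, 'r, 'r) mseq"
    and \<phi> :: "'d rvec \<Rightarrow> complex ^ 'r"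
  assumes "\<And>l. mabs (\<nu> l) \<le> m"
    and "\<nu> i1 = 0"
    and "finitely_supported a"
    and "hermite_convergent m \<nu> a"
    and "basis_vector_function m i1 a \<phi>"
    and "m \<le> M"
  shows "(hermite_sum_rules (M + 1) \<nu> \<tau> a \<longleftrightarrow> polynomial_interpolation M \<nu> \<tau> a) \<and>
    (polynomial_interpolation M \<nu> \<tau> a \<longleftrightarrow> scheme_reproduces_polynomials M \<nu> \<tau> a) \<and>
    (hermite_sum_rules (M + 1) \<nu> \<tau> a \<or> polynomial_interpolation M \<nu> \<tau> a
        \<or> scheme_reproduces_polynomials M \<nu> \<tau> a \<longrightarrow>
      (\<forall>p\<in>polys M.
        let w = hermite_scheme \<nu> a (hermite_data \<nu> \<tau> p);
            \<eta> = conv_basis (hermite_data \<nu> \<tau> p) \<phi>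
        in Cm m \<eta> \<and>
          (\<forall>l. \<forall>K>0.
            (\<lambda>n. Max ((\<lambda>k. cmod (w n k $ 1 $ l
                                  - mdiff (\<nu> l) \<eta> ((1/2) ^ n *\<^sub>R (emb k + \<tau> l))))
                      ` lattice_box (2 ^ n * K)))
            \<longlonglongrightarrow> 0) \<and>
          (\<forall>l k. \<forall>n\<ge>1. w n k $ 1 $ l = mdiff (\<nu> l) \<eta> ((1/2) ^ n *\<^sub>R (emb k + \<tau> l)))) \<and>
      (\<forall>\<theta>. (\<forall>l. \<nu> (\<theta> l) = \<nu> l) \<longrightarrow>
        (\<forall>p\<in>polys M.
          let w = hermite_scheme \<nu> a (hermite_data \<nu> \<tau> p)
          in \<exists>W. (\<forall>n. vector_polynomial_extension (w n) (W n)) \<and>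
            (\<forall>k. \<forall>n\<ge>1. \<forall>l.
              W n (2 *\<^sub>R emb k + 2 *\<^sub>R \<tau> l - \<tau> (\<theta> l)) $ 1 $ \<theta> l = w (n - 1) k $ 1 $ l))))"
proof -
  have sr: "hermite_sum_rules (M + 1) \<nu> \<tau> a \<longleftrightarrow> polynomial_interpolation M \<nu> \<tau> a"
    unfolding polynomial_interpolation_iff_subdiv
    by (rule hermite_sum_rules_iff_subdiv[of a \<nu> i1, OF assms(3,2)])
  have pi: "polynomial_interpolation M \<nu> \<tau> a \<longleftrightarrow> scheme_reproduces_polynomials M \<nu> \<tau> a"
    by (rule polynomial_interpolation_iff_scheme)
  obtain R where R: "R \<ge> 0" "\<And>k i. a k \<noteq> 0 \<Longrightarrow> \<bar>k $ i\<bar> \<le> R"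
    using mask_bound[OF assms(3)] by metis
  have item_i: "Cm m \<eta> \<and>
      (\<forall>l. \<forall>K>0. (\<lambda>n. Max ((\<lambda>k. cmod (w n k $ 1 $ l
          - mdiff (\<nu> l) \<eta> ((1/2) ^ n *\<^sub>R (emb k + \<tau> l)))) ` lattice_box (2 ^ n * K))) \<longlonglongrightarrow> 0) \<and>
      (\<forall>l k. \<forall>n\<ge>1. w n k $ 1 $ l = mdiff (\<nu> l) \<eta> ((1/2) ^ n *\<^sub>R (emb k + \<tau> l)))"
    if int: "polynomial_interpolation M \<nu> \<tau> a" and p: "p \<in> polys M"
      and w_def: "w = hermite_scheme \<nu> a (hermite_data \<nu> \<tau> p)"
      and \<eta>_def: "\<eta> = conv_basis (hermite_data \<nu> \<tau> p) \<phi>" for p w \<eta>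
  proof -
    \<comment> \<open>With this identification the reproduction formula makes every error term
      vanish exactly, at each level.\<close>
    have \<eta>: "\<eta> = p"
      unfolding \<eta>_def by (rule conv_basis_hermite_data[OF assms(5,3) R int assms(2) p])
    have "w n = (\<lambda>k. \<chi> _ l. mdiff (\<nu> l) p ((1/2) ^ n *\<^sub>R (emb k + \<tau> l)))" for n
      using int p unfolding pi scheme_reproduces_polynomials_def w_def by blast
    then have w: "w n k $ 1 $ l = mdiff (\<nu> l) \<eta> ((1/2) ^ n *\<^sub>R (emb k + \<tau> l))" for n k l
      by (simp add: \<eta>)
    have "Max ((\<lambda>k. cmod (w n k $ 1 $ l - mdiff (\<nu> l) \<eta> ((1/2) ^ n *\<^sub>R (emb k + \<tau> l))))
        ` lattice_box (2 ^ n * K)) = 0" if "K > 0" for n K l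
    proof -
      \<comment> \<open>The box must be nonempty for \<open>Max\<close> to be the maximum of the set
        {0}; this is where \<open>K > 0\<close> enters.\<close>
      have "(0 :: 'd ivec) \<in> lattice_box (2 ^ n * K)"
        using that by (simp add: lattice_box_def)
      then have "(\<lambda>k :: 'd ivec. 0 :: real) ` lattice_box (2 ^ n * K) = {0}"
        by blast
      then show ?thesis by (simp add: w)
    qed
    moreover have "Cm m \<eta>"
      unfolding \<eta> using polys_exppoly[OF p] by (rule exppoly_Cm)
    ultimately show ?thesis
      using w by simp
  qed
  show ?thesis
  proof (intro conjI impI ballI allI sr pi)
    assume "hermite_sum_rules (M + 1) \<nu> \<tau> a \<or> polynomial_interpolation M \<nu> \<tau> a
        \<or> scheme_reproduces_polynomials M \<nu> \<tau> a"
    then have int: "polynomial_interpolation M \<nu> \<tau> a"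
      using sr pi by blast
    fix p :: "'d rvec \<Rightarrow> complex" assume p: "p \<in> polys M"
    show "let w = hermite_scheme \<nu> a (hermite_data \<nu> \<tau> p); \<eta> = conv_basis (hermite_data \<nu> \<tau> p) \<phi>
        in Cm m \<eta> \<and>
          (\<forall>l. \<forall>K>0.
            (\<lambda>n. Max ((\<lambda>k. cmod (w n k $ 1 $ l
                                  - mdiff (\<nu> l) \<eta> ((1/2) ^ n *\<^sub>R (emb k + \<tau> l))))
                      ` lattice_box (2 ^ n * K)))
            \<longlonglongrightarrow> 0) \<and>
          (\<forall>l k. \<forall>n\<ge>1. w n k $ 1 $ l = mdiff (\<nu> l) \<eta> ((1/2) ^ n *\<^sub>R (emb k + \<tau> l)))"
      unfolding Let_def by (rule item_i[OF int p refl refl])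
    fix \<theta> assume "\<forall>l. \<nu> (\<theta> l) = \<nu> l"
    then show "let w = hermite_scheme \<nu> a (hermite_data \<nu> \<tau> p)
          in \<exists>W. (\<forall>n. vector_polynomial_extension (w n) (W n)) \<and>
            (\<forall>k. \<forall>n\<ge>1. \<forall>l.
              W n (2 *\<^sub>R emb k + 2 *\<^sub>R \<tau> l - \<tau> (\<theta> l)) $ 1 $ \<theta> l = w (n - 1) k $ 1 $ l)"
      using int p unfolding Let_def pi by (intro scheme_component_relation) simp_all
  qed
qed

end
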